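(* Let $M_1^N$ and $M_2^N$ be closed smooth oriented $N$-manifolds each of which admits a totally real immersion into $\mathbb{C}^N$. Then there is a totally real immersion $M_1^N\#\overline{M_2^N}\to\mathbb{C}^N$.
   Context: Let $J$ be the standard complex structure on the tangent bundle of $\mathbb{C}^N$. An immersion $f: M^N\to\mathbb{C}^N$ of a closed smooth $N$-manifold is totally real if at every point $x\in M^N$ the real subspace $V=df_x(T_xM)$ satisfies $V\cap JV=\{0\}$. The symbol $\#$ denotes the (oriented) connected sum, and $\overline{M}$ denotes $M$ with the opposite orientation. *)

theory Defs
  imports "HOL-Analysis.Analysis"
begin

section \<open>Smooth maps between open subsets of Euclidean spaces\<close>

text \<open>
  \<open>k_smooth_on k S f\<close> is meant for open \<open>S\<close> and finite-dimensional domains, where it says that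
  \<open>f\<close> is of class \<open>C^k\<close> on \<open>S\<close>: all directional derivatives of the derivative are \<open>C^(k-1)\<close>.
\<close>

primrec k_smooth_on ::
  "nat \<Rightarrow> 'a::euclidean_space set \<Rightarrow> ('a \<Rightarrow> 'b::euclidean_space) \<Rightarrow> bool" where
  "k_smooth_on 0 S f \<longleftrightarrow> continuous_on S f"
| "k_smooth_on (Suc k) S f \<longleftrightarrow>
     (\<forall>x\<in>S. f differentiable (at x)) \<and>
     (\<forall>v. k_smooth_on k S (\<lambda>x. frechet_derivative f (at x) v))"

definition smooth_on :: "'a::euclidean_space set \<Rightarrow> ('a \<Rightarrow> 'b::euclidean_space) \<Rightarrow> bool" where
  "smooth_on S f \<longleftrightarrow> (\<forall>k. k_smooth_on k S f)"


section \<open>Closed oriented smooth manifolds\<close>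

text \<open>
  A chart is a pair of its domain and its coordinate map; the values of the coordinate map
  outside of the domain are irrelevant. The smooth structure and the orientation are both given
  by the atlas, which is not required to be maximal. The dimension is \<open>CARD('n)\<close>, so it is at
  least 1.
\<close>

record ('a, 'n::finite) oriented_manifold =
  top_of :: "'a topology"
  charts :: "('a set \<times> ('a \<Rightarrow> real ^ 'n)) set"

definition is_chart :: "'a topology \<Rightarrow> 'a set \<times> ('a \<Rightarrow> real ^ 'n) \<Rightarrow> bool" where
  "is_chart X = (\<lambda>(U, \<phi>). openin X U \<and> open (\<phi> ` U) \<and>
     homeomorphic_map (subtopology X U) (top_of_set (\<phi> ` U)) \<phi>)"

definition oriented_transition ::
  "'a set \<times> ('a \<Rightarrow> real ^ 'n) \<Rightarrow> 'a set \<times> ('a \<Rightarrow> real ^ 'n) \<Rightarrow> bool" where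
  "oriented_transition = (\<lambda>(U, \<phi>) (V, \<psi>).
     smooth_on (\<phi> ` (U \<inter> V)) (\<psi> \<circ> inv_into U \<phi>) \<and>
     (\<forall>z \<in> \<phi> ` (U \<inter> V). det (jacobian (\<psi> \<circ> inv_into U \<phi>) (at z)) > 0))"

definition closed_oriented_manifold :: "('a, 'n::finite) oriented_manifold \<Rightarrow> bool" where
  "closed_oriented_manifold M \<longleftrightarrow>
     Hausdorff_space (top_of M) \<and> second_countable (top_of M) \<and> compact_space (top_of M) \<and>
     (\<forall>c \<in> charts M. is_chart (top_of M) c) \<and>
     (\<Union>c \<in> charts M. fst c) = topspace (top_of M) \<and>
     (\<forall>c \<in> charts M. \<forall>d \<in> charts M. oriented_transition c d)"

text \<open>
  The opposite orientation: compose the charts with all linear automorphisms that reverse the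
  orientation of the coordinate space. Any single one would do; taking all avoids a choice.
\<close>

definition opposite :: "('a, 'n::finite) oriented_manifold \<Rightarrow> ('a, 'n) oriented_manifold" where
  "opposite M = \<lparr>top_of = top_of M,
     charts = {(U, \<lambda>x. R *v \<phi> x) | U \<phi> (R :: real ^ 'n ^ 'n). (U, \<phi>) \<in> charts M \<and> det R < 0}\<rparr>"


section \<open>Totally real immersions\<close>

definition J :: "complex ^ 'n \<Rightarrow> complex ^ 'n" where
  "J v = \<i> *s v"

definition smooth_map :: "('a, 'n::finite) oriented_manifold \<Rightarrow> ('a \<Rightarrow> complex ^ 'n) \<Rightarrow> bool" where
  "smooth_map M f \<longleftrightarrow> (\<forall>(U, \<phi>) \<in> charts M. smooth_on (\<phi> ` U) (f \<circ> inv_into U \<phi>))"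

text \<open>
  The differential of \<open>f\<close> at \<open>x\<close>, where a chart \<open>(U, \<phi>)\<close> around \<open>x\<close> is used to identify the
  tangent space at \<open>x\<close> with the coordinate space. Its range does not depend on the chart.
\<close>

definition differential ::
  "'a set \<times> ('a \<Rightarrow> real ^ 'n) \<Rightarrow> ('a \<Rightarrow> complex ^ 'n) \<Rightarrow> 'a \<Rightarrow> real ^ 'n \<Rightarrow> complex ^ 'n" where
  "differential = (\<lambda>(U, \<phi>) f x. frechet_derivative (f \<circ> inv_into U \<phi>) (at (\<phi> x)))"

definition immersion :: "('a, 'n::finite) oriented_manifold \<Rightarrow> ('a \<Rightarrow> complex ^ 'n) \<Rightarrow> bool" where
  "immersion M f \<longleftrightarrow> smooth_map M f \<and>
     (\<forall>c \<in> charts M. \<forall>x \<in> fst c. inj (differential c f x))"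

definition totally_real_immersion ::
  "('a, 'n::finite) oriented_manifold \<Rightarrow> ('a \<Rightarrow> complex ^ 'n) \<Rightarrow> bool" where
  "totally_real_immersion M f \<longleftrightarrow> immersion M f \<and>
     (\<forall>c \<in> charts M. \<forall>x \<in> fst c.
        range (differential c f x) \<inter> J ` range (differential c f x) = {0})"


section \<open>Oriented connected sums\<close>

text \<open>
  A smooth embedding of an open subset \<open>W\<close> of the coordinate space into a manifold of the same
  dimension, i.e. a diffeomorphism from \<open>W\<close> onto an open subset.
\<close>

definition open_embedding ::
  "('a, 'n::finite) oriented_manifold \<Rightarrow> (real ^ 'n) set \<Rightarrow> (real ^ 'n \<Rightarrow> 'a) \<Rightarrow> bool" where
  "open_embedding M W i \<longleftrightarrow> open W \<and> openin (top_of M) (i ` W) \<and>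
     homeomorphic_map (top_of_set W) (subtopology (top_of M) (i ` W)) i \<and>
     (\<forall>(U, \<phi>) \<in> charts M.
        smooth_on (W \<inter> i -` U) (\<phi> \<circ> i) \<and>
        smooth_on (\<phi> ` (U \<inter> i ` W)) (inv_into W i \<circ> inv_into U \<phi>))"

text \<open>
  Smooth embeddings of the closed unit disc, where smoothness on the closed disc means that there
  is a smooth extension to a neighbourhood.
\<close>

definition preserving_disc ::
  "('a, 'n::finite) oriented_manifold \<Rightarrow> (real ^ 'n \<Rightarrow> 'a) \<Rightarrow> bool" where
  "preserving_disc M i \<longleftrightarrow> (\<exists>W. cball 0 1 \<subseteq> W \<and> open_embedding M W i \<and>
     (\<forall>(U, \<phi>) \<in> charts M. \<forall>z \<in> W \<inter> i -` U. det (jacobian (\<phi> \<circ> i) (at z)) > 0))"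

definition reversing_disc ::
  "('a, 'n::finite) oriented_manifold \<Rightarrow> (real ^ 'n \<Rightarrow> 'a) \<Rightarrow> bool" where
  "reversing_disc M i \<longleftrightarrow> (\<exists>W. cball 0 1 \<subseteq> W \<and> open_embedding M W i \<and>
     (\<forall>(U, \<phi>) \<in> charts M. \<forall>z \<in> W \<inter> i -` U. det (jacobian (\<phi> \<circ> i) (at z)) < 0))"

text \<open>
  The connected sum along discs \<open>i\<^sub>1\<close> and \<open>i\<^sub>2\<close>, as in Kervaire and Milnor, Groups of homotopy
  spheres I: remove the centres of both discs from the disjoint union and identify
  \<open>i\<^sub>1 (t u)\<close> with \<open>i\<^sub>2 ((1 - t) u)\<close> for every unit vector \<open>u\<close> and \<open>0 < t < 1\<close>. It is the
  oriented connected sum if \<open>i\<^sub>1\<close> preserves and \<open>i\<^sub>2\<close> reverses the orientation. The points of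
  the connected sum are the equivalence classes of this gluing.
\<close>

definition punctured :: "('a, 'n::finite) oriented_manifold \<Rightarrow> (real ^ 'n \<Rightarrow> 'a) \<Rightarrow> 'a set" where
  "punctured M i = topspace (top_of M) - {i 0}"

definition glued ::
  "(real ^ 'n \<Rightarrow> 'a) \<Rightarrow> (real ^ 'n \<Rightarrow> 'b) \<Rightarrow> (('a + 'b) \<times> ('a + 'b)) set" where
  "glued i1 i2 = {(Inl (i1 (t *\<^sub>R u)), Inr (i2 ((1 - t) *\<^sub>R u))) | t u. norm u = 1 \<and> 0 < t \<and> t < 1}"

definition gluing ::
  "('a, 'n::finite) oriented_manifold \<Rightarrow> ('b, 'n) oriented_manifold \<Rightarrow>
   (real ^ 'n \<Rightarrow> 'a) \<Rightarrow> (real ^ 'n \<Rightarrow> 'b) \<Rightarrow> (('a + 'b) \<times> ('a + 'b)) set" where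
  "gluing M1 M2 i1 i2 =
     Id_on (punctured M1 i1 <+> punctured M2 i2) \<union> glued i1 i2 \<union> (glued i1 i2)\<inverse>"

definition csum_inl ::
  "('a, 'n::finite) oriented_manifold \<Rightarrow> ('b, 'n) oriented_manifold \<Rightarrow>
   (real ^ 'n \<Rightarrow> 'a) \<Rightarrow> (real ^ 'n \<Rightarrow> 'b) \<Rightarrow> 'a \<Rightarrow> ('a + 'b) set" where
  "csum_inl M1 M2 i1 i2 x = gluing M1 M2 i1 i2 `` {Inl x}"

definition csum_inr ::
  "('a, 'n::finite) oriented_manifold \<Rightarrow> ('b, 'n) oriented_manifold \<Rightarrow>
   (real ^ 'n \<Rightarrow> 'a) \<Rightarrow> (real ^ 'n \<Rightarrow> 'b) \<Rightarrow> 'b \<Rightarrow> ('a + 'b) set" where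
  "csum_inr M1 M2 i1 i2 y = gluing M1 M2 i1 i2 `` {Inr y}"

text \<open>The quotient topology of the disjoint union of the two punctured manifolds.\<close>

definition csum_topology ::
  "('a, 'n::finite) oriented_manifold \<Rightarrow> ('b, 'n) oriented_manifold \<Rightarrow>
   (real ^ 'n \<Rightarrow> 'a) \<Rightarrow> (real ^ 'n \<Rightarrow> 'b) \<Rightarrow> ('a + 'b) set topology" where
  "csum_topology M1 M2 i1 i2 = topology (\<lambda>T.
     T \<subseteq> (punctured M1 i1 <+> punctured M2 i2) // gluing M1 M2 i1 i2 \<and>
     openin (subtopology (top_of M1) (punctured M1 i1))
       {x \<in> punctured M1 i1. csum_inl M1 M2 i1 i2 x \<in> T} \<and>
     openin (subtopology (top_of M2) (punctured M2 i2))
       {y \<in> punctured M2 i2. csum_inr M1 M2 i1 i2 y \<in> T})"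

definition push_charts ::
  "'a set \<Rightarrow> ('a \<Rightarrow> 'c) \<Rightarrow> ('a set \<times> ('a \<Rightarrow> real ^ 'n)) set \<Rightarrow> ('c set \<times> ('c \<Rightarrow> real ^ 'n)) set" where
  "push_charts S j A = {(j ` (U \<inter> S), \<phi> \<circ> inv_into S j) | U \<phi>. (U, \<phi>) \<in> A}"

definition connected_sum ::
  "('a, 'n::finite) oriented_manifold \<Rightarrow> ('b, 'n) oriented_manifold \<Rightarrow>
   (real ^ 'n \<Rightarrow> 'a) \<Rightarrow> (real ^ 'n \<Rightarrow> 'b) \<Rightarrow> (('a + 'b) set, 'n) oriented_manifold" where
  "connected_sum M1 M2 i1 i2 = \<lparr>top_of = csum_topology M1 M2 i1 i2,
     charts = push_charts (punctured M1 i1) (csum_inl M1 M2 i1 i2) (charts M1) \<union>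
              push_charts (punctured M2 i2) (csum_inr M1 M2 i1 i2) (charts M2)\<rparr>"


subsection \<open>Well-definedness of the gluing\<close>

lemma open_embedding_disc:
  assumes "open_embedding M W i" and "cball 0 1 \<subseteq> W"
  shows "inj_on i (cball 0 1)" and "i ` cball 0 1 \<subseteq> topspace (top_of M)"
proof -
  have "inj_on i W"
    using assms(1) by (auto simp: open_embedding_def homeomorphic_map_def)
  then show "inj_on i (cball 0 1)"
    using assms(2) inj_on_subset by blast
  show "i ` cball 0 1 \<subseteq> topspace (top_of M)"
    using assms openin_subset by (fastforce simp: open_embedding_def)
qed

lemma preserving_disc:
  assumes "preserving_disc M i"
  shows "inj_on i (cball 0 1)" and "i ` cball 0 1 \<subseteq> topspace (top_of M)"
  using assms open_embedding_disc unfolding preserving_disc_def by blast+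

lemma reversing_disc:
  assumes "reversing_disc M i"
  shows "inj_on i (cball 0 1)" and "i ` cball 0 1 \<subseteq> topspace (top_of M)"
  using assms open_embedding_disc unfolding reversing_disc_def by blast+

lemma disc_in_punctured:
  fixes i :: "real ^ 'n::finite \<Rightarrow> 'a"
  assumes "inj_on i (cball 0 1)" and "i ` cball 0 1 \<subseteq> topspace (top_of M)"
    and "norm u = 1" and "0 < t" and "t < 1"
  shows "i (t *\<^sub>R u) \<in> punctured M i"
proof -
  have "t *\<^sub>R u \<in> cball 0 1" "(0 :: real ^ 'n) \<in> cball 0 1" "t *\<^sub>R u \<noteq> 0"
    using assms(3-5) by auto
  then show ?thesis
    using assms(1,2) unfolding punctured_def by (auto dest: inj_onD)
qed

lemma polar_eq:
  assumes "inj_on i (cball 0 1)" and "i (t *\<^sub>R u) = i (s *\<^sub>R v)"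
    and "norm u = 1" "0 < t" "t < 1" "norm v = 1" "0 < s" "s < 1"
  shows "t = s \<and> u = v"
proof -
  have eq: "t *\<^sub>R u = s *\<^sub>R v"
    using assms by (intro inj_onD[OF assms(1)]) auto
  then have "norm (t *\<^sub>R u) = norm (s *\<^sub>R v)" by simp
  then have "t = s" using assms by simp
  then show ?thesis using eq assms by simp
qed

lemma glued_functional:
  assumes "inj_on i1 (cball 0 1)" and "inj_on i2 (cball 0 1)"
  shows "single_valued (glued i1 i2)" and "single_valued ((glued i1 i2)\<inverse>)"
proof -
  have 1: "i2 ((1 - t) *\<^sub>R u) = i2 ((1 - s) *\<^sub>R v)"
    if "i1 (t *\<^sub>R u) = i1 (s *\<^sub>R v)" "norm u = 1" "0 < t" "t < 1" "norm v = 1" "0 < s" "s < 1"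
    for t s u v
    using polar_eq[OF assms(1) that] by simp
  show "single_valued (glued i1 i2)"
    by (rule single_valuedI) (auto simp: glued_def intro: 1)
  have 2: "i1 (t *\<^sub>R u) = i1 (s *\<^sub>R v)"
    if "i2 ((1 - t) *\<^sub>R u) = i2 ((1 - s) *\<^sub>R v)"
      "norm u = 1" "0 < t" "t < 1" "norm v = 1" "0 < s" "s < 1"
    for t s u v
    using polar_eq[OF assms(2), of "1 - t" u "1 - s" v] that by simp
  show "single_valued ((glued i1 i2)\<inverse>)"
    by (rule single_valuedI) (auto simp: glued_def intro: 2)
qed

lemma equiv_gluing:
  assumes i1: "inj_on i1 (cball 0 1)" "i1 ` cball 0 1 \<subseteq> topspace (top_of M1)"
    and i2: "inj_on i2 (cball 0 1)" "i2 ` cball 0 1 \<subseteq> topspace (top_of M2)"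
  shows "equiv (punctured M1 i1 <+> punctured M2 i2) (gluing M1 M2 i1 i2)"
proof -
  let ?D = "punctured M1 i1 <+> punctured M2 i2"
  have sub: "gluing M1 M2 i1 i2 \<subseteq> ?D \<times> ?D"
    using disc_in_punctured[OF i1] disc_in_punctured[OF i2]
    by (auto simp: gluing_def glued_def)
  have "trans (gluing M1 M2 i1 i2)"
  proof (rule transI)
    fix p q r
    assume pq: "(p, q) \<in> gluing M1 M2 i1 i2" and qr: "(q, r) \<in> gluing M1 M2 i1 i2"
    have D: "p \<in> ?D" "r \<in> ?D" using sub pq qr by auto
    consider "p = q" | "q = r" | "(p, q) \<in> glued i1 i2" "(q, r) \<in> (glued i1 i2)\<inverse>"
      | "(p, q) \<in> (glued i1 i2)\<inverse>" "(q, r) \<in> glued i1 i2"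
      using pq qr unfolding gluing_def by (auto simp: glued_def)
    then show "(p, r) \<in> gluing M1 M2 i1 i2"
    proof cases
      case 3
      then have "(q, p) \<in> (glued i1 i2)\<inverse>" by simp
      then have "p = r"
        using 3(2) glued_functional(2)[OF i1(1) i2(1)] unfolding single_valued_def by blast
      then show ?thesis using D by (auto simp: gluing_def)
    next
      case 4
      then have "(q, p) \<in> glued i1 i2" by simp
      then have "p = r"
        using 4(2) glued_functional(1)[OF i1(1) i2(1)] unfolding single_valued_def by blast
      then show ?thesis using D by (auto simp: gluing_def)
    qed (use pq qr in auto)
  qed
  moreover have "sym (gluing M1 M2 i1 i2)"
    unfolding gluing_def by (auto simp: sym_def)
  moreover have "refl_on ?D (gluing M1 M2 i1 i2)"
    unfolding refl_on_def gluing_def by auto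
  ultimately show ?thesis
    using sub by (simp add: equiv_def)
qed

lemma csum_inl_inj: "inj_on (csum_inl M1 M2 i1 i2) (punctured M1 i1)"
proof (rule inj_onI)
  fix x y
  assume x: "x \<in> punctured M1 i1" and eq: "csum_inl M1 M2 i1 i2 x = csum_inl M1 M2 i1 i2 y"
  have "Inl x \<in> csum_inl M1 M2 i1 i2 x"
    using x by (auto simp: csum_inl_def gluing_def)
  then have "Inl x \<in> csum_inl M1 M2 i1 i2 y" using eq by simp
  then show "x = y" by (auto simp: csum_inl_def gluing_def glued_def)
qed

lemma csum_inr_inj: "inj_on (csum_inr M1 M2 i1 i2) (punctured M2 i2)"
proof (rule inj_onI)
  fix x y
  assume x: "x \<in> punctured M2 i2" and eq: "csum_inr M1 M2 i1 i2 x = csum_inr M1 M2 i1 i2 y"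
  have "Inr x \<in> csum_inr M1 M2 i1 i2 x"
    using x by (auto simp: csum_inr_def gluing_def)
  then have "Inr x \<in> csum_inr M1 M2 i1 i2 y" using eq by simp
  then show "x = y" by (auto simp: csum_inr_def gluing_def glued_def)
qed

lemma openin_csum_topology:
  fixes M1 :: "('a, 'n::finite) oriented_manifold" and M2 :: "('b, 'n) oriented_manifold"
  shows
  "openin (csum_topology M1 M2 i1 i2) T \<longleftrightarrow>
     T \<subseteq> (punctured M1 i1 <+> punctured M2 i2) // gluing M1 M2 i1 i2 \<and>
     openin (subtopology (top_of M1) (punctured M1 i1))
       {x \<in> punctured M1 i1. csum_inl M1 M2 i1 i2 x \<in> T} \<and>
     openin (subtopology (top_of M2) (punctured M2 i2))
       {y \<in> punctured M2 i2. csum_inr M1 M2 i1 i2 y \<in> T}"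
proof -
  have *: "istopology (\<lambda>T. T \<subseteq> C \<and> openin X {x \<in> A. f x \<in> T} \<and> openin Y {y \<in> B. g y \<in> T})"
    for X :: "'a topology" and Y :: "'b topology" and A B and C :: "('a + 'b) set set" and f g
  proof -
    have Int: "{x \<in> A. f x \<in> S \<inter> T} = {x \<in> A. f x \<in> S} \<inter> {x \<in> A. f x \<in> T}"
      "{y \<in> B. g y \<in> S \<inter> T} = {y \<in> B. g y \<in> S} \<inter> {y \<in> B. g y \<in> T}" for S T
      by blast+
    have Un: "{x \<in> A. f x \<in> \<Union>K} = (\<Union>S\<in>K. {x \<in> A. f x \<in> S})"
      "{y \<in> B. g y \<in> \<Union>K} = (\<Union>S\<in>K. {y \<in> B. g y \<in> S})" for K
      by blast+
    show ?thesis
      unfolding istopology_def Int Un by (auto intro!: openin_Int openin_Union)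
  qed
  show ?thesis
    unfolding csum_topology_def by (subst topology_inverse'[OF *]) (rule refl)
qed

end

theory Submission
  imports Defs
begin

text \<open>
  Composing with complex affine maps, both immersions can be assumed to be tangent to the standard
  inclusion of \<open>real ^ 'n\<close> at the centres of the discs. On the neck, use a Polterovich handle
  \<open>t u \<mapsto> (a t + \<i> a (1 - t)) u\<close>, where \<open>u\<close> is a unit vector and \<open>a\<close> vanishes
  near \<open>0\<close> and is then strictly increasing: this is totally real because the curve
  \<open>\<gamma> t = a t + \<i> a (1 - t)\<close> and its derivative vanish nowhere. The two summands are
  replaced by the given immersions of the discs, composed with the radial maps \<open>t u \<mapsto> a t u\<close>
  and \<open>t u \<mapsto> a (1 - t) u\<close>. Where both contribute, \<open>a\<close> is so small that the
  immersions are \<open>C^1\<close>-close to the inclusion, which does not destroy total reality. As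
  \<open>a t = t\<close> near \<open>t = 1\<close>, the resulting map agrees with the given immersions outside of the discs
  (up to a factor \<open>\<i>\<close> on the second manifold).
\<close>

section \<open>Smooth maps\<close>

text \<open>Where both summands contribute, the derivative is
  \<open>D\<^sub>1 (P v) + \<sigma> *\<^sub>R J (D\<^sub>2 (Q v))\<close>, with \<open>P\<close> and
  \<open>Q\<close> the derivatives of the two radial maps. The obstacle is that \<open>P\<close> or
  \<open>Q\<close> degenerates towards the ends of this region and that the profile comes with no
  bound on its derivative, so smallness in absolute terms would not do. Errors are therefore
  measured against \<open>P v\<close> and \<open>Q v\<close> themselves: \<open>D\<^sub>1\<close>
  and \<open>D\<^sub>2\<close> are within relative distance 1/4 of one and the same map
  \<open>incl\<close>, which is why both immersions are normalised at their centres. In the model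
  with \<open>incl\<close> in place of both, the squared norm on complexified vectors is exactly the
  sum of four squared norms, because \<open>P\<close> and \<open>Q\<close> are diagonal in the same
  splitting into radial and tangential directions. Four errors of 1/4 add up to at most half of the
  model norm, so the kernel stays trivial however small the profile is. Working with kernels of
  complexified derivatives also makes total reality visibly stable under injective real changes of
  coordinates and complex linear automorphisms.\<close>

lemma k_smooth_on_cong:
  assumes "open S"
  shows "k_smooth_on k S f \<Longrightarrow> (\<And>x. x \<in> S \<Longrightarrow> f x = g x) \<Longrightarrow> k_smooth_on k S g"
proof (induction k arbitrary: f g)
  case 0
  then show ?case by (simp cong: continuous_on_cong)
next
  case (Suc k)
  have g: "(g has_derivative frechet_derivative f (at x)) (at x)" if "x \<in> S" for x
    using Suc.prems that assms
    by (auto simp: frechet_derivative_works intro: has_derivative_transform_within_open)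
  have "k_smooth_on k S (\<lambda>x. frechet_derivative g (at x) v)" for v
  proof (rule Suc.IH)
    show "k_smooth_on k S (\<lambda>x. frechet_derivative f (at x) v)"
      using Suc.prems(1) by simp
    show "frechet_derivative f (at x) v = frechet_derivative g (at x) v" if "x \<in> S" for x
      using frechet_derivative_at[OF g[OF that]] by simp
  qed
  then show ?case
    using g by (auto simp: differentiable_def)
qed

text \<open>Allows an explicit derivative in place of the chosen \<open>frechet_derivative\<close>;
  the two agree on \<open>S\<close>, and openness lets the smoothness of one pass to the
  other.\<close>

lemma k_smooth_on_Suc:
  assumes "open S" and "\<And>x. x \<in> S \<Longrightarrow> (f has_derivative f' x) (at x)"
    and "\<And>v. k_smooth_on k S (\<lambda>x. f' x v)"
  shows "k_smooth_on (Suc k) S f"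
proof -
  have "k_smooth_on k S (\<lambda>x. frechet_derivative f (at x) v)" for v
    using frechet_derivative_at[OF assms(2)] by (auto intro: k_smooth_on_cong[OF assms(1) assms(3)[of v]])
  then show ?thesis
    using assms(2) by (auto simp: differentiable_def)
qed

lemma k_smooth_on_has_derivative:
  assumes "k_smooth_on (Suc k) S f" and "x \<in> S"
  shows "(f has_derivative frechet_derivative f (at x)) (at x)"
  using assms by (simp add: frechet_derivative_works)

lemma k_smooth_on_mono: "k_smooth_on k S f \<Longrightarrow> T \<subseteq> S \<Longrightarrow> k_smooth_on k T f"
  by (induction k arbitrary: f) (auto intro: continuous_on_subset)

lemma k_smooth_on_Suc_imp: "k_smooth_on (Suc k) S f \<Longrightarrow> k_smooth_on k S f"
proof (induction k arbitrary: f)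
  case 0
  then show ?case
    by (auto intro!: continuous_at_imp_continuous_on differentiable_imp_continuous_within)
next
  case (Suc k)
  have "k_smooth_on (Suc k) S (\<lambda>x. frechet_derivative f (at x) v)" for v
    using Suc.prems by (subst (asm) k_smooth_on.simps) blast
  moreover have "\<forall>x\<in>S. f differentiable (at x)"
    using Suc.prems by simp
  ultimately show ?case
    using Suc.IH by (subst k_smooth_on.simps) blast
qed

text \<open>Derivatives are taken at points of the whole space and do not see the set, so only the
  continuity in the base case needs the topology of \<open>S\<close>.\<close>

lemma k_smooth_on_local:
  "(\<And>x. x \<in> S \<Longrightarrow> \<exists>T. open T \<and> x \<in> T \<and> k_smooth_on k (S \<inter> T) f) \<Longrightarrow> k_smooth_on k S f"
proof (induction k arbitrary: f)
  case 0
  have "continuous (at x within S) f" if x: "x \<in> S" for x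
  proof -
    obtain T where T: "open T" "x \<in> T" "continuous_on (S \<inter> T) f"
      using 0[OF x] by auto
    then have "continuous (at x within S \<inter> T) f"
      using x by (simp add: continuous_on_eq_continuous_within)
    then show ?thesis
      using at_within_nhd[OF T(2,1), of "S \<inter> T" S] by (simp add: continuous_within Int_ac)
  qed
  then show ?case by (simp add: continuous_on_eq_continuous_within)
next
  case (Suc k)
  then show ?case by (fastforce)
qed

lemma k_smooth_on_const [simp]: "k_smooth_on k S (\<lambda>x. c)"
  by (induction k arbitrary: c) auto

lemma k_smooth_on_linear: 
  assumes "bounded_linear L"
  shows "k_smooth_on k S f \<Longrightarrow> open S \<Longrightarrow> k_smooth_on k S (\<lambda>x. L (f x))"
proof (induction k arbitrary: f)
  case 0
  then show ?case using linear_continuous_on_compose[of S f L] assms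
    by (simp add: bounded_linear.linear bounded_linear.continuous_on)
next
  case (Suc k)
  then show ?case
    by (intro k_smooth_on_Suc[where f'="\<lambda>x v. L (frechet_derivative f (at x) v)"])
       (auto simp: frechet_derivative_works intro: bounded_linear.has_derivative[OF assms])
qed

lemma k_smooth_on_add:
  "k_smooth_on k S f \<Longrightarrow> k_smooth_on k S g \<Longrightarrow> open S \<Longrightarrow> k_smooth_on k S (\<lambda>x. f x + g x)"
proof (induction k arbitrary: f g)
  case 0
  then show ?case by (simp add: continuous_on_add)
next
  case (Suc k)
  then show ?case
    by (intro k_smooth_on_Suc[where f'="\<lambda>x v. frechet_derivative f (at x) v + frechet_derivative g (at x) v"])
       (auto simp: frechet_derivative_works intro: has_derivative_add)
qed

lemma k_smooth_on_sum:
  assumes "\<And>i. i \<in> I \<Longrightarrow> k_smooth_on k S (f i)" and "open S"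
  shows "k_smooth_on k S (\<lambda>x. \<Sum>i\<in>I. f i x)"
  using assms by (induction I rule: infinite_finite_induct) (auto intro: k_smooth_on_add)

lemma k_smooth_on_bilinear:
  assumes "bounded_bilinear B"
  shows "k_smooth_on k S f \<Longrightarrow> k_smooth_on k S g \<Longrightarrow> open S \<Longrightarrow> k_smooth_on k S (\<lambda>x. B (f x) (g x))"
proof (induction k arbitrary: f g)
  case 0
  then show ?case by (simp add: bounded_bilinear.continuous_on[OF assms])
next
  case (Suc k)
  have "k_smooth_on k S f" "k_smooth_on k S g"
    using Suc.prems(1,2)[THEN k_smooth_on_Suc_imp] .
  then show ?case
    using Suc
    by (intro k_smooth_on_Suc[where f'="\<lambda>x v. B (f x) (frechet_derivative g (at x) v) +
          B (frechet_derivative f (at x) v) (g x)"])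
       (auto simp: frechet_derivative_works intro: bounded_bilinear.FDERIV[OF assms] k_smooth_on_add)
qed

lemma linear_expand:
  assumes "linear f"
  shows "f v = (\<Sum>b\<in>Basis. (v \<bullet> b) *\<^sub>R f b)"
proof -
  have "f v = f (\<Sum>b\<in>Basis. (v \<bullet> b) *\<^sub>R b)"
    by (simp add: euclidean_representation)
  then show ?thesis
    by (simp add: linear_sum[OF assms] linear_cmul[OF assms])
qed

text \<open>In the chain rule the direction in which \<open>g\<close> is differentiated depends on
  \<open>x\<close>, whereas \<open>k_smooth_on\<close> speaks of fixed directions. Expanding that
  direction in the basis leaves products of functions to which the induction hypothesis and the
  product rule apply.\<close>

lemma k_smooth_on_compose:
  fixes f :: "'a::euclidean_space \<Rightarrow> 'b::euclidean_space" and g :: "'b \<Rightarrow> 'c::euclidean_space"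
  shows "k_smooth_on k S f \<Longrightarrow> k_smooth_on k T g \<Longrightarrow> f ` S \<subseteq> T \<Longrightarrow> open S \<Longrightarrow>
    k_smooth_on k S (\<lambda>x. g (f x))"
proof (induction k arbitrary: f g)
  case 0
  then show ?case by (auto intro: continuous_on_compose2)
next
  case (Suc k)
  let ?D = "\<lambda>x v. \<Sum>b\<in>Basis. (frechet_derivative f (at x) v \<bullet> b) *\<^sub>R frechet_derivative g (at (f x)) b"
  have f: "k_smooth_on k S f"
    using Suc.prems(1) by (rule k_smooth_on_Suc_imp)
  show ?case
  proof (rule k_smooth_on_Suc[where f' = ?D])
    fix x assume x: "x \<in> S"
    have f': "(f has_derivative frechet_derivative f (at x)) (at x)"
      using Suc.prems(1) x by (rule k_smooth_on_has_derivative)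
    have g': "(g has_derivative frechet_derivative g (at (f x))) (at (f x))"
      using Suc.prems(2,3) x by (intro k_smooth_on_has_derivative) auto
    show "((\<lambda>x. g (f x)) has_derivative ?D x) (at x)"
      using has_derivative_compose[OF f' g']
      by (simp add: linear_expand[OF has_derivative_linear[OF g'], of "frechet_derivative f (at x) _", symmetric])
  next
    fix v
    have "k_smooth_on k S (\<lambda>x. frechet_derivative f (at x) v \<bullet> b)" for b
      using Suc.prems by (auto intro: k_smooth_on_linear[OF bounded_linear_inner_left])
    moreover have "k_smooth_on k S (\<lambda>x. frechet_derivative g (at (f x)) b)" for b
      using Suc.prems f by (intro Suc.IH) auto
    ultimately show "k_smooth_on k S (\<lambda>x. ?D x v)"
      using Suc.prems(4) by (intro k_smooth_on_sum k_smooth_on_bilinear[OF bounded_bilinear_scaleR])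
  qed (use Suc.prems in auto)
qed

lemma smooth_on_cong: "open S \<Longrightarrow> smooth_on S f \<Longrightarrow> (\<And>x. x \<in> S \<Longrightarrow> f x = g x) \<Longrightarrow> smooth_on S g"
  unfolding smooth_on_def using k_smooth_on_cong by blast

lemma smooth_on_mono: "smooth_on S f \<Longrightarrow> T \<subseteq> S \<Longrightarrow> smooth_on T f"
  unfolding smooth_on_def using k_smooth_on_mono by blast

lemma smooth_on_local:
  "(\<And>x. x \<in> S \<Longrightarrow> \<exists>T. open T \<and> x \<in> T \<and> smooth_on (S \<inter> T) f) \<Longrightarrow> smooth_on S f"
  unfolding smooth_on_def by (intro allI k_smooth_on_local) blast

lemma smooth_on_const [simp]: "smooth_on S (\<lambda>x. c)"
  by (simp add: smooth_on_def)

lemma smooth_on_linear: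
  "bounded_linear L \<Longrightarrow> smooth_on S f \<Longrightarrow> open S \<Longrightarrow> smooth_on S (\<lambda>x. L (f x))"
  by (simp add: smooth_on_def k_smooth_on_linear)

lemma smooth_on_id [simp]: "smooth_on S (\<lambda>x. x)"
  unfolding smooth_on_def
proof
  fix k show "k_smooth_on k S (\<lambda>x. x)"
    by (cases k) auto
qed

lemma smooth_on_add:
  "smooth_on S f \<Longrightarrow> smooth_on S g \<Longrightarrow> open S \<Longrightarrow> smooth_on S (\<lambda>x. f x + g x)"
  by (simp add: smooth_on_def k_smooth_on_add)

lemma smooth_on_bilinear:
  "bounded_bilinear B \<Longrightarrow> smooth_on S f \<Longrightarrow> smooth_on S g \<Longrightarrow> open S \<Longrightarrow>
    smooth_on S (\<lambda>x. B (f x) (g x))"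
  by (simp add: smooth_on_def k_smooth_on_bilinear)

lemmas smooth_on_mult = smooth_on_bilinear[OF bounded_bilinear_mult]
  and smooth_on_scaleR = smooth_on_bilinear[OF bounded_bilinear_scaleR]
  and smooth_on_inner = smooth_on_bilinear[OF bounded_bilinear_inner]

lemma smooth_on_diff:
  "smooth_on S f \<Longrightarrow> smooth_on S g \<Longrightarrow> open S \<Longrightarrow> smooth_on S (\<lambda>x. f x - g x)"
  using smooth_on_add[of S f "\<lambda>x. - g x"]
    smooth_on_linear[OF bounded_linear_minus[OF bounded_linear_ident], of S g] by simp

lemma smooth_on_compose:
  "smooth_on S f \<Longrightarrow> smooth_on T g \<Longrightarrow> f ` S \<subseteq> T \<Longrightarrow> open S \<Longrightarrow> smooth_on S (\<lambda>x. g (f x))"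
  unfolding smooth_on_def using k_smooth_on_compose by blast

lemma smooth_on_has_derivative:
  assumes "smooth_on S f" and "x \<in> S"
  shows "(f has_derivative frechet_derivative f (at x)) (at x)"
  using assms k_smooth_on_has_derivative unfolding smooth_on_def by blast

lemma smooth_on_continuous_derivative:
  assumes "smooth_on S f"
  shows "continuous_on S (\<lambda>x. frechet_derivative f (at x) v)"
  using assms[unfolded smooth_on_def, rule_format, of "Suc 0"] by simp

section \<open>Elementary smooth functions: inverse, square root, norm, quotients\<close>

lemma k_smooth_on_real_Suc:
  fixes f :: "real \<Rightarrow> real"
  assumes "open S" and "\<And>x. x \<in> S \<Longrightarrow> (f has_real_derivative f' x) (at x)" and "k_smooth_on k S f'"
  shows "k_smooth_on (Suc k) S f"
proof (rule k_smooth_on_Suc[where f'="\<lambda>x v. f' x * v"])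
  show "(f has_derivative (\<lambda>v. f' x * v)) (at x)" if "x \<in> S" for x
    using assms(2)[OF that] by (simp add: has_field_derivative_def)
  show "k_smooth_on k S (\<lambda>x. f' x * v)" for v
    using k_smooth_on_linear[OF bounded_linear_mult_left assms(3,1)] .
qed (use assms in auto)

text \<open>The derivative is a polynomial in \<open>inverse\<close> itself, so order
  \<open>k\<close> of the function gives order \<open>k\<close> of its derivative. The square root
  below is treated in the same way.\<close>

lemma smooth_on_inverse: "smooth_on (- {0::real}) inverse"
  unfolding smooth_on_def
proof
  fix k show "k_smooth_on k (- {0::real}) inverse"
  proof (induction k)
    case (Suc k)
    show ?case
    proof (rule k_smooth_on_real_Suc[where f'="\<lambda>x. - (inverse x * inverse x)"])
      show "k_smooth_on k (- {0::real}) (\<lambda>x. - (inverse x * inverse x))"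
        by (intro k_smooth_on_linear[OF bounded_linear_minus[OF bounded_linear_ident]]
            k_smooth_on_bilinear[OF bounded_bilinear_mult] Suc) auto
      show "(inverse has_real_derivative - (inverse x * inverse x)) (at x)" if "x \<in> - {0}" for x :: real
        using DERIV_inverse[of x UNIV] that by (simp add: power2_eq_square numeral_2_eq_2 power_inverse)
    qed auto
  qed (auto intro!: continuous_on_inverse)
qed

lemma smooth_on_sqrt: "smooth_on {0<..} sqrt"
  unfolding smooth_on_def
proof
  fix k show "k_smooth_on k {0<..} sqrt"
  proof (induction k)
    case (Suc k)
    show ?case
    proof (rule k_smooth_on_real_Suc[where f'="\<lambda>x. inverse (sqrt x) * (1 / 2)"])
      have "k_smooth_on k (- {0}) (inverse :: real \<Rightarrow> real)"
        using smooth_on_inverse by (simp add: smooth_on_def)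
      then show "k_smooth_on k {0<..} (\<lambda>x. inverse (sqrt x) * (1 / 2))"
        by (intro k_smooth_on_linear[OF bounded_linear_mult_left] k_smooth_on_compose[OF Suc]) auto
      show "(sqrt has_real_derivative inverse (sqrt x) * (1 / 2)) (at x)" if "x \<in> {0<..}" for x
        using DERIV_real_sqrt[of x] that by simp
    qed auto
  qed (auto intro!: continuous_intros)
qed

lemma smooth_on_norm: "smooth_on (- {0}) (norm :: 'a::euclidean_space \<Rightarrow> real)"
  unfolding norm_eq_sqrt_inner
  by (rule smooth_on_compose[OF smooth_on_inner smooth_on_sqrt]) auto

lemma smooth_on_divide:
  fixes f g :: "'a::euclidean_space \<Rightarrow> real"
  assumes "smooth_on S f" "smooth_on S g" "open S" "\<And>x. x \<in> S \<Longrightarrow> g x \<noteq> 0"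
  shows "smooth_on S (\<lambda>x. f x / g x)"
  unfolding divide_inverse
  by (intro smooth_on_mult smooth_on_compose[OF assms(2) smooth_on_inverse]) (use assms in auto)

section \<open>Smooth step functions\<close>

text \<open>For \<open>n = 0\<close> this is the classical function exp(-1/x), extended by 0. The
  powers of 1/x make the family closed under differentiation up to linear combinations, so
  smoothness of all members follows by one induction.\<close>

definition flat :: "nat \<Rightarrow> real \<Rightarrow> real" where
  "flat n x = (if x > 0 then inverse x ^ n * exp (- inverse x) else 0)"

lemma flat_pos: "0 < flat n x \<longleftrightarrow> 0 < x"
  by (simp add: flat_def)

lemma flat_nonneg: "0 \<le> flat n x"
  by (simp add: flat_def)

lemma flat_eq_0: "flat n x = 0 \<longleftrightarrow> x \<le> 0"
  using flat_pos[of n x] flat_nonneg[of n x] by linarith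

lemma flat_0_less_1: "flat 0 x < 1"
  by (simp add: flat_def)

lemma flat_tendsto_0: "(flat n \<longlongrightarrow> 0) (at 0)"
proof -
  have "((\<lambda>x::real. inverse x ^ n / exp (inverse x)) \<longlongrightarrow> 0) (at_right 0)"
    by (rule filterlim_compose[OF tendsto_power_div_exp_0 filterlim_inverse_at_top_right])
  moreover have "eventually (\<lambda>x. inverse x ^ n / exp (inverse x) = flat n x) (at_right 0)"
    by (simp add: eventually_at_right_less flat_def exp_minus field_simps eventually_at_filter)
  ultimately have "(flat n \<longlongrightarrow> 0) (at_right 0)"
    by (rule Lim_transform_eventually)
  moreover have "(flat n \<longlongrightarrow> 0) (at_left 0)"
    by (rule Lim_transform_eventually[OF tendsto_const]) (simp add: eventually_at_filter flat_def)
  ultimately show ?thesis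
    by (simp add: filterlim_split_at)
qed

lemma flat_has_derivative:
  "(flat n has_real_derivative flat (n + 2) x - real n * flat (n + 1) x) (at x)"
proof -
  consider "x > 0" | "x < 0" | "x = 0" by linarith
  then show ?thesis
  proof cases
    case 1
    have "((\<lambda>x. inverse x ^ n * exp (- inverse x)) has_real_derivative
        flat (n + 2) x - real n * flat (n + 1) x) (at x)"
      using 1 by (auto intro!: derivative_eq_intros simp: flat_def)
        (cases n; simp add: field_simps power2_eq_square)
    then show ?thesis
      by (rule has_field_derivative_transform_within_open[of _ _ _ "{0<..}"])
         (use 1 in \<open>auto simp: flat_def\<close>)
  next
    case 2
    have "((\<lambda>x. 0) has_real_derivative 0) (at x)" by simp
    then have "(flat n has_real_derivative 0) (at x)"
      by (rule has_field_derivative_transform_within_open[of _ _ _ "{..<0}"])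
         (use 2 in \<open>auto simp: flat_def\<close>)
    then show ?thesis using 2 by (simp add: flat_def)
  next
    case 3
    \<comment> \<open>The difference quotient at 0 is the next member of the family, which also
      tends to 0.\<close>
    have "((\<lambda>h. flat n h / h) \<longlongrightarrow> 0) (at 0)"
      by (rule Lim_transform_eventually[OF flat_tendsto_0[of "Suc n"]])
         (auto simp: flat_def divide_inverse eventually_at_filter)
    then show ?thesis
      using 3 by (simp add: DERIV_def flat_def)
  qed
qed

lemma DERIV_flat_0:
  assumes "(g has_real_derivative g') (at t)"
  shows "((\<lambda>t. flat 0 (g t)) has_real_derivative flat 2 (g t) * g') (at t)"
  using DERIV_chain2[OF _ assms, of "flat 0"] flat_has_derivative[of 0 "g t"]
  by (simp add: numeral_2_eq_2)

lemma smooth_on_flat: "smooth_on UNIV (flat n)"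
  unfolding smooth_on_def
proof
  fix k show "k_smooth_on k UNIV (flat n)"
  proof (induction k arbitrary: n)
    case 0
    show ?case
      using flat_has_derivative by (auto intro!: continuous_at_imp_continuous_on DERIV_isCont)
  next
    case (Suc k)
    have "k_smooth_on k UNIV (\<lambda>x. flat (n + 2) x + (- real n) * flat (n + 1) x)"
      by (intro k_smooth_on_add Suc k_smooth_on_linear[OF bounded_linear_mult_right]) auto
    then show ?case
      by (intro k_smooth_on_real_Suc[OF _ flat_has_derivative]) auto
  qed
qed

text \<open>The usual quotient A / (A + B) of two flat functions, one growing from \<alpha> and one
  dying at \<beta>; as \<alpha> < \<beta>, at least one of them is positive everywhere. The
  derivative is returned too, since its sign and zeros enter the monotonicity of the
  profile.\<close>

lemma smooth_step:
  fixes \<alpha> \<beta> :: real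
  assumes "\<alpha> < \<beta>"
  obtains s s' where "smooth_on UNIV s" and "\<And>t. (s has_real_derivative s' t) (at t)"
    and "\<And>t. t \<le> \<alpha> \<Longrightarrow> s t = 0" "\<And>t. t \<le> \<alpha> \<Longrightarrow> s' t = 0" "\<And>t. \<beta> \<le> t \<Longrightarrow> s t = 1"
    and "\<And>t. 0 \<le> s t" "\<And>t. s t \<le> 1" "\<And>t. 0 \<le> s' t"
proof -
  define A where "A t = flat 0 (t - \<alpha>)" for t
  define B where "B t = flat 0 (\<beta> - t)" for t
  define s' where "s' t = (flat 2 (t - \<alpha>) * (A t + B t) - A t * (flat 2 (t - \<alpha>) - flat 2 (\<beta> - t)))
      / ((A t + B t) * (A t + B t))" for t
  have pos: "A t + B t > 0" for t
    using assms flat_pos[of 0 "t - \<alpha>"] flat_pos[of 0 "\<beta> - t"]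
      flat_nonneg[of 0 "t - \<alpha>"] flat_nonneg[of 0 "\<beta> - t"]
    unfolding A_def B_def by argo
  have nonneg: "0 \<le> A t" "0 \<le> B t" for t
    by (simp_all add: A_def B_def flat_nonneg)
  have dA: "(A has_real_derivative flat 2 (t - \<alpha>)) (at t)" for t
    unfolding A_def by (rule DERIV_cong[OF DERIV_flat_0]) (auto intro!: derivative_eq_intros)
  have dB: "(B has_real_derivative - flat 2 (\<beta> - t)) (at t)" for t
    unfolding B_def by (rule DERIV_cong[OF DERIV_flat_0[where g'="- 1"]]) (auto intro!: derivative_eq_intros)
  have smA: "smooth_on UNIV A" and smB: "smooth_on UNIV B"
    unfolding A_def B_def by (auto intro!: smooth_on_compose[OF smooth_on_diff smooth_on_flat])
  show thesis
  proof
    show "smooth_on UNIV (\<lambda>t. A t / (A t + B t))"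
      using pos by (intro smooth_on_divide smooth_on_add smA smB) (auto simp: less_imp_neq[symmetric])
    show "((\<lambda>t. A t / (A t + B t)) has_real_derivative s' t) (at t)" for t
      using pos[of t] by (auto intro!: derivative_eq_intros dA dB simp: s'_def)
    show "0 \<le> s' t" for t
    proof -
      have "flat 2 (t - \<alpha>) * (A t + B t) - A t * (flat 2 (t - \<alpha>) - flat 2 (\<beta> - t)) =
          flat 2 (t - \<alpha>) * B t + A t * flat 2 (\<beta> - t)"
        by (simp add: algebra_simps)
      then show ?thesis
        unfolding s'_def using pos[of t] nonneg[of t] flat_nonneg by simp
    qed
    show "A t / (A t + B t) = 0" "s' t = 0" if "t \<le> \<alpha>" for t
      using that by (simp_all add: A_def s'_def flat_eq_0[THEN iffD2])
    show "A t / (A t + B t) = 1" if "\<beta> \<le> t" for t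
      using that pos[of t] flat_eq_0[of 0 "\<beta> - t"] by (simp add: B_def)
    show "0 \<le> A t / (A t + B t)" "A t / (A t + B t) \<le> 1" for t
      using pos[of t] nonneg[of t] by (simp_all add: divide_le_eq_1)
  qed
qed

text \<open>Vanishing up to 1/3 confines the overlap of \<open>a t\<close> and
  \<open>a (1 - t)\<close> to 1/3 < t < 2/3, where the bound \<open>r\<close> keeps both radial maps
  near the centre. The bound 1 keeps them inside the open disc, and the identity from 5/6 on fits
  the neck to the given immersion.\<close>

definition radial_profile :: "real \<Rightarrow> (real \<Rightarrow> real) \<Rightarrow> (real \<Rightarrow> real) \<Rightarrow> bool" where
  "radial_profile r a a' \<longleftrightarrow> smooth_on UNIV a \<and>
     (\<forall>t. (a has_real_derivative a' t) (at t)) \<and>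
     (\<forall>t\<le>1/3. a t = 0 \<and> a' t = 0) \<and> (\<forall>t>1/3. 0 < a t \<and> 0 < a' t) \<and>
     (\<forall>t\<le>2/3. a t < r) \<and> (\<forall>t<1. a t < 1) \<and> (\<forall>t\<ge>5/6. a t = t)"

lemma radial_profile_exists:
  assumes "0 < r"
  shows "\<exists>a a'. radial_profile r a a'"
proof -
  obtain s s' where s: "smooth_on UNIV s" "\<And>t. (s has_real_derivative s' t) (at t)"
    "\<And>t. t \<le> 2/3 \<Longrightarrow> s t = 0" "\<And>t. t \<le> 2/3 \<Longrightarrow> s' t = 0" "\<And>t. 5/6 \<le> t \<Longrightarrow> s t = 1"
    "\<And>t. 0 \<le> s t" "\<And>t. s t \<le> 1" "\<And>t. 0 \<le> s' t"
    using smooth_step[of "2/3" "5/6"] by auto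
  \<comment> \<open>Less than \<open>r\<close> for the smallness up to 2/3, and at most 1/2 so that
    \<open>p t\<close> stays below \<open>t\<close> and below 1 where the step is active.\<close>
  define \<delta> where "\<delta> = min r 1 / 2"
  define p where "p t = \<delta> * flat 0 (t - 1/3)" for t
  define p' where "p' t = \<delta> * flat 2 (t - 1/3)" for t
  \<comment> \<open>Interpolates between the small flat function and the identity; the switch takes
    place between 2/3 and 5/6.\<close>
  define a where "a t = p t * (1 - s t) + s t * t" for t
  define a' where "a' t = p' t * (1 - s t) + s' t * (t - p t) + s t" for t
  have \<delta>: "0 < \<delta>" "\<delta> < r" "\<delta> \<le> 1/2" using assms by (auto simp: \<delta>_def)
  have p_less: "p t < \<delta>" for t using \<delta> flat_0_less_1[of "t - 1/3"] by (simp add: p_def)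
  have dp: "(p has_real_derivative p' t) (at t)" for t
    unfolding p_def p'_def
    by (intro DERIV_cmult DERIV_cong[OF DERIV_flat_0]) (auto intro!: derivative_eq_intros)
  have pp: "0 < p t" "0 < p' t" if "t > 1/3" for t
    using that \<delta> flat_pos by (simp_all add: p_def p'_def)
  have p0: "p t = 0" "p' t = 0" if "t \<le> 1/3" for t
    using that flat_eq_0 by (simp_all add: p_def p'_def)
  have p_nonneg: "0 \<le> p t" for t using \<delta> flat_nonneg by (simp add: p_def)
  have "smooth_on UNIV p"
    unfolding p_def
    by (intro smooth_on_mult smooth_on_const smooth_on_compose[OF smooth_on_diff smooth_on_flat]) auto
  then have "smooth_on UNIV a"
    unfolding a_def by (intro smooth_on_add smooth_on_mult smooth_on_diff s(1)) auto
  moreover have "(a has_real_derivative a' t) (at t)" for t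
    unfolding a_def a'_def by (rule derivative_eq_intros dp s(2) refl)+ (simp add: algebra_simps)
  moreover have "a t = 0 \<and> a' t = 0" if "t \<le> 1/3" for t
    using that s(3,4)[of t] p0[of t] by (simp add: a_def a'_def)
  moreover have "0 < a t \<and> 0 < a' t" if "t > 1/3" for t
  proof -
    \<comment> \<open>Either the step is still constant, or t > 2/3 > \<open>p t\<close>.\<close>
    have *: "0 \<le> s' t * (t - p t)"
      using s(4)[of t] s(8)[of t] p_less[of t] \<delta> by (cases "t \<le> 2/3") auto
    \<comment> \<open>Convex combinations of positive numbers are positive; needed once for
      \<open>a\<close> and once for the main part of \<open>a'\<close>.\<close>
    have "0 < x * (1 - s t) + s t * y" if "0 < x" "0 < y" for x y
    proof (cases "s t = 0")
      case False
      then have "0 < s t * y" using that s(6)[of t] by simp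
      moreover have "0 \<le> x * (1 - s t)" using that s(7)[of t] by simp
      ultimately show ?thesis by simp
    qed (use that in simp)
    from this[of "p t" t] this[of "p' t" 1] show ?thesis
      using * pp[OF that] that by (simp add: a_def a'_def)
  qed
  moreover have "a t < r" if "t \<le> 2/3" for t
    using that s(3)[of t] p_less[of t] \<delta> by (simp add: a_def)
  moreover have "a t < 1" if "t < 1" for t
  proof -
    have "p t < 1" using p_less[of t] \<delta> by simp
    from convex_bound_lt[OF this that, of "1 - s t" "s t"] show ?thesis
      using s(6,7)[of t] by (simp add: a_def mult.commute)
  qed
  moreover have "a t = t" if "t \<ge> 5/6" for t
    using s(5)[OF that] by (simp add: a_def)
  ultimately show ?thesis
    unfolding radial_profile_def by blast
qed

section \<open>Totally real linear maps\<close>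

text \<open>That is, the complexification of \<open>D\<close> is injective.\<close>

definition tot_real :: "('v::real_vector \<Rightarrow> complex ^ 'n) \<Rightarrow> bool" where
  "tot_real D \<longleftrightarrow> (\<forall>v w. D v + J (D w) = 0 \<longrightarrow> v = 0 \<and> w = 0)"

definition incl :: "real ^ 'n \<Rightarrow> complex ^ 'n" where
  "incl v = (\<chi> k. of_real (v $ k))"

lemma J_add: "J (v + w) = J v + J w"
  and J_minus: "J (- v) = - J v"
  and J_diff: "J (v - w) = J v - J w"
  and J_scaleR: "J (r *\<^sub>R v) = r *\<^sub>R J v"
  and J_J: "J (J v) = - v"
  by (simp_all add: J_def vec_eq_iff algebra_simps)

lemma linear_J: "linear J"
  by (intro linearI J_add J_scaleR)

lemma bounded_linear_J: "bounded_linear (J :: complex ^ 'n::finite \<Rightarrow> _)"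
  using linear_J by (simp add: linear_conv_bounded_linear)

lemma linear_incl: "linear incl"
  by (rule linearI) (simp_all add: incl_def vec_eq_iff complex_eq_iff)

lemma norm_J [simp]: "norm (J v) = norm v"
  by (simp add: norm_vec_def J_def norm_mult)

lemma J_eq_0_iff [simp]: "J v = 0 \<longleftrightarrow> v = 0"
  using norm_J[of v] by (metis norm_eq_zero)

lemma norm_incl_J: "(norm (incl p + J (incl q)))\<^sup>2 = (norm p)\<^sup>2 + (norm q)\<^sup>2"
proof -
  have "(norm (incl p + J (incl q)))\<^sup>2 = (\<Sum>k\<in>UNIV. (p $ k)\<^sup>2 + (q $ k)\<^sup>2)"
    by (simp add: norm_vec_def L2_set_def sum_nonneg incl_def J_def cmod_power2)
  then show ?thesis
    by (simp add: norm_vec_def L2_set_def sum_nonneg sum.distrib)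
qed

lemma tot_real_inj: "linear D \<Longrightarrow> tot_real D \<Longrightarrow> D v = 0 \<Longrightarrow> v = 0"
  unfolding tot_real_def using linear_0 J_eq_0_iff by (metis add.right_neutral)

lemma tot_real_compose:
  assumes "tot_real D" and "\<And>v. P v = 0 \<Longrightarrow> v = 0"
  shows "tot_real (\<lambda>v. D (P v))"
  using assms unfolding tot_real_def by blast

lemma tot_real_post:
  assumes "tot_real D" and "linear L" and "\<And>v. L (J v) = J (L v)" and "\<And>v. L v = 0 \<Longrightarrow> v = 0"
  shows "tot_real (\<lambda>v. L (D v))"
  using assms unfolding tot_real_def by (metis linear_add)

text \<open>With \<open>incl\<close> in place of both maps, this is the complex operator P +
  i\<sigma>Q applied to v + iw. The hypothesis \<open>sym\<close> cancels the mixed terms of its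
  squared norm, leaving \<open>S\<close>. The actual map differs by errors whose squared total is at
  most S/4, so a kernel vector has S \<le> S/4 and hence S = 0.\<close>

lemma tot_real_neck:
  fixes D\<^sub>1 D\<^sub>2 :: "real ^ 'n \<Rightarrow> complex ^ 'n"
  assumes D1: "\<And>v. norm (D\<^sub>1 v - incl v) \<le> norm v / 4"
    and D2: "\<And>v. norm (D\<^sub>2 v - incl v) \<le> norm v / 4"
    and \<sigma>: "\<sigma> * \<sigma> = 1"
    and sym: "\<And>v w. Q v \<bullet> P w = P v \<bullet> Q w"
    and inj: "\<And>v. P v = 0 \<Longrightarrow> Q v = 0 \<Longrightarrow> v = 0"
  shows "tot_real (\<lambda>v. D\<^sub>1 (P v) + \<sigma> *\<^sub>R J (D\<^sub>2 (Q v)))"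
  unfolding tot_real_def
proof (intro allI impI)
  fix v w
  assume "D\<^sub>1 (P v) + \<sigma> *\<^sub>R J (D\<^sub>2 (Q v)) + J (D\<^sub>1 (P w) + \<sigma> *\<^sub>R J (D\<^sub>2 (Q w))) = 0"
  then have 0: "D\<^sub>1 (P v) + \<sigma> *\<^sub>R J (D\<^sub>2 (Q v)) + J (D\<^sub>1 (P w)) - \<sigma> *\<^sub>R D\<^sub>2 (Q w) = 0"
    by (simp add: J_add J_scaleR J_J add_diff_eq)
  define S where "S = (norm (P v))\<^sup>2 + (norm (Q v))\<^sup>2 + (norm (P w))\<^sup>2 + (norm (Q w))\<^sup>2"
  \<comment> \<open>Real and imaginary parts of (P + i\<sigma>Q)(v + iw), that is, the vanishing
    expression with both derivatives replaced by \<open>incl\<close>.\<close>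
  define X where "X = incl (P v - \<sigma> *\<^sub>R Q w) + J (incl (\<sigma> *\<^sub>R Q v + P w))"
  have \<sigma>': "\<bar>\<sigma>\<bar> = 1"
    using \<sigma> by (metis abs_mult abs_one abs_ge_zero abs_mult_self_eq power2_eq_1_iff power2_eq_square abs_1 abs_minus)
  have "X = D\<^sub>1 (P v) + \<sigma> *\<^sub>R J (D\<^sub>2 (Q v)) + J (D\<^sub>1 (P w)) - \<sigma> *\<^sub>R D\<^sub>2 (Q w)
    - ((D\<^sub>1 (P v) - incl (P v)) + \<sigma> *\<^sub>R J (D\<^sub>2 (Q v) - incl (Q v))
      + J (D\<^sub>1 (P w) - incl (P w)) - \<sigma> *\<^sub>R (D\<^sub>2 (Q w) - incl (Q w)))"
    by (simp add: X_def J_add J_diff J_scaleR linear_add[OF linear_incl] linear_diff[OF linear_incl]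
        linear_cmul[OF linear_incl] algebra_simps)
  then have "norm X = norm ((D\<^sub>1 (P v) - incl (P v)) + \<sigma> *\<^sub>R J (D\<^sub>2 (Q v) - incl (Q v))
      + J (D\<^sub>1 (P w) - incl (P w)) - \<sigma> *\<^sub>R (D\<^sub>2 (Q w) - incl (Q w)))" (is "_ = norm (?a + ?b + ?c - ?d)")
    unfolding 0 by (simp add: norm_minus_commute)
  also have "\<dots> \<le> norm ?a + norm ?b + norm ?c + norm ?d"
    by (intro norm_triangle_le_diff add_mono norm_triangle_le order_refl)
  also have "\<dots> \<le> (norm (P v) + norm (Q v) + norm (P w) + norm (Q w)) / 4"
    using D1[of "P v"] D2[of "Q v"] D1[of "P w"] D2[of "Q w"] \<sigma>' by simp
  finally have "(norm X)\<^sup>2 \<le> ((norm (P v) + norm (Q v) + norm (P w) + norm (Q w)) / 4)\<^sup>2"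
    by (rule power_mono) simp
  also have "\<dots> \<le> S / 4"
  proof -
    \<comment> \<open>The difference of the two sides is the sum of the squares of the six pairwise
      differences.\<close>
    have "(p + q + r + s)\<^sup>2 \<le> 4 * (p\<^sup>2 + q\<^sup>2 + r\<^sup>2 + s\<^sup>2)" for p q r s :: real
      using sum_squares_ge_zero[of "p - q" "r - s"] sum_squares_ge_zero[of "p - r" "q - s"]
        sum_squares_ge_zero[of "p - s" "q - r"]
      by (simp add: power2_eq_square algebra_simps)
    from this[of "norm (P v)" "norm (Q v)" "norm (P w)" "norm (Q w)"] show ?thesis
      by (simp add: S_def power_divide)
  qed
  \<comment> \<open>Rewrites the left end of the chain, which thus becomes S \<le> S/4.\<close>
  also have "(norm X)\<^sup>2 = S"
  proof -
    have "(norm X)\<^sup>2 = (norm (P v - \<sigma> *\<^sub>R Q w))\<^sup>2 + (norm (\<sigma> *\<^sub>R Q v + P w))\<^sup>2"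
      by (simp only: X_def norm_incl_J)
    also have "\<dots> = (norm (P v))\<^sup>2 + (\<sigma> * \<sigma>) * (norm (Q w))\<^sup>2 + (\<sigma> * \<sigma>) * (norm (Q v))\<^sup>2 + (norm (P w))\<^sup>2
        + 2 * \<sigma> * (Q v \<bullet> P w - P v \<bullet> Q w)"
      by (simp only: power2_norm_eq_inner) (simp add: inner_simps inner_commute algebra_simps)
    finally show ?thesis by (simp add: \<sigma> sym S_def)
  qed
  finally have "S \<le> 0" by simp
  then have "P v = 0 \<and> Q v = 0 \<and> P w = 0 \<and> Q w = 0"
    unfolding S_def by (smt (verit) zero_le_power2 power2_eq_square mult_eq_0_iff norm_eq_zero)
  then show "v = 0 \<and> w = 0"
    using inj by blast
qed

section \<open>Radial maps, t u \<mapsto> b(t) u in polar coordinates, and their derivatives\<close>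

definition radial :: "(real \<Rightarrow> real) \<Rightarrow> 'a::euclidean_space \<Rightarrow> 'a" where
  "radial b x = (b (norm x) / norm x) *\<^sub>R x"

text \<open>For a unit vector \<open>u\<close>, the diagonal operator with eigenvalue \<beta> on the
  line of \<open>u\<close> and \<gamma> on its orthogonal complement.\<close>

definition radial_deriv :: "real \<Rightarrow> real \<Rightarrow> 'a::euclidean_space \<Rightarrow> 'a \<Rightarrow> 'a" where
  "radial_deriv \<beta> \<gamma> u w = (\<beta> * (w \<bullet> u)) *\<^sub>R u + \<gamma> *\<^sub>R (w - (w \<bullet> u) *\<^sub>R u)"

lemma norm_radial: "x \<noteq> 0 \<Longrightarrow> norm (radial b x) = \<bar>b (norm x)\<bar>"
  by (simp add: radial_def)

lemma smooth_on_radial: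
  assumes "smooth_on UNIV b"
  shows "smooth_on (- {0}) (radial b :: 'a::euclidean_space \<Rightarrow> 'a)"
  unfolding radial_def
  by (intro smooth_on_scaleR smooth_on_divide smooth_on_compose[OF smooth_on_norm assms]
      smooth_on_norm smooth_on_id) auto

text \<open>Radially the map stretches by \<open>b'\<close>; tangentially it scales the sphere of
  radius t to that of radius b(t), which gives the factor b(t)/t.\<close>

lemma radial_has_derivative:
  fixes x :: "'a::euclidean_space"
  assumes "x \<noteq> 0" and b: "(b has_real_derivative b') (at (norm x))"
  shows "(radial b has_derivative radial_deriv b' (b (norm x) / norm x) (sgn x)) (at x)"
proof -
  have n: "(norm has_derivative (\<lambda>w. w \<bullet> sgn x)) (at x)"
    using has_derivative_norm[OF assms(1)] by (simp add: inner_commute)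
  have bn: "((\<lambda>x. b (norm x)) has_derivative (\<lambda>w. b' * (w \<bullet> sgn x))) (at x)"
    using has_derivative_compose[OF n b[unfolded has_field_derivative_def]] by simp
  have "norm x \<noteq> 0" using assms(1) by simp
  have "(radial b has_derivative (\<lambda>w. (b (norm x) / norm x) *\<^sub>R w +
     (- b (norm x) * (inverse (norm x) * (w \<bullet> sgn x) * inverse (norm x)) + b' * (w \<bullet> sgn x) / norm x) *\<^sub>R x)) (at x)"
    unfolding radial_def
    by (intro has_derivative_scaleR has_derivative_ident has_derivative_divide[OF bn n] \<open>norm x \<noteq> 0\<close>)
  moreover have "(b (norm x) / norm x) *\<^sub>R w +
     (- b (norm x) * (inverse (norm x) * (w \<bullet> sgn x) * inverse (norm x)) + b' * (w \<bullet> sgn x) / norm x) *\<^sub>R x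
     = radial_deriv b' (b (norm x) / norm x) (sgn x) w" for w
    using assms(1) by (simp add: radial_deriv_def sgn_div_norm algebra_simps divide_inverse)
  ultimately show ?thesis by (auto intro: has_derivative_eq_rhs)
qed

text \<open>Both operators are self-adjoint and diagonal in the same splitting, hence they commute.
  This supplies the hypothesis \<open>sym\<close> of \<open>tot_real_neck\<close>.\<close>

lemma radial_deriv_sym:
  assumes "norm u = 1"
  shows "radial_deriv \<beta>' \<gamma>' u v \<bullet> radial_deriv \<beta> \<gamma> u w = radial_deriv \<beta> \<gamma> u v \<bullet> radial_deriv \<beta>' \<gamma>' u w"
proof -
  have "u \<bullet> u = 1" using assms by (simp add: dot_square_norm)
  then show ?thesis
    by (simp add: radial_deriv_def inner_simps inner_commute algebra_simps)
qed

lemma radial_deriv_eq_0: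
  assumes "norm u = 1" and "radial_deriv \<beta> \<gamma> u v = 0"
  shows "\<beta> = 0 \<or> v \<bullet> u = 0" and "\<gamma> = 0 \<or> v = (v \<bullet> u) *\<^sub>R u"
proof -
  have u: "u \<bullet> u = 1" using assms by (simp add: dot_square_norm)
  have "radial_deriv \<beta> \<gamma> u v \<bullet> u = \<beta> * (v \<bullet> u)"
    using u by (simp add: radial_deriv_def inner_simps)
  then show *: "\<beta> = 0 \<or> v \<bullet> u = 0" using assms(2) by simp
  then show "\<gamma> = 0 \<or> v = (v \<bullet> u) *\<^sub>R u"
    using assms(2) by (auto simp: radial_deriv_def)
qed

lemma radial_deriv_inj:
  assumes "norm u = 1" and "\<beta> \<noteq> 0" and "\<gamma> \<noteq> 0" and "radial_deriv \<beta> \<gamma> u v = 0"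
  shows "v = 0"
  using radial_deriv_eq_0[OF assms(1,4)] assms(2,3) by auto

section \<open>The neck\<close>

lemma J_0 [simp]: "J 0 = 0"
  by (simp add: J_def vec_eq_iff)

text \<open>By the chain rule, the smooth left inverse \<open>k\<close> makes the derivative of
  \<open>h\<close> injective. All changes of coordinates below are handled through this.\<close>

lemma tot_real_derivative_compose:
  assumes "smooth_on A h" "open A" "smooth_on B k" "smooth_on B K" "h ` A \<subseteq> B"
    and "\<And>z. z \<in> A \<Longrightarrow> k (h z) = z" and z: "z \<in> A"
    and "tot_real (frechet_derivative K (at (h z)))"
  shows "tot_real (frechet_derivative (\<lambda>z. K (h z)) (at z))"
proof -
  have hz: "h z \<in> B" using assms(5) z by blast
  have h: "(h has_derivative frechet_derivative h (at z)) (at z)"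
    using assms(1) z by (rule smooth_on_has_derivative)
  have "((\<lambda>z. k (h z)) has_derivative (\<lambda>v. frechet_derivative k (at (h z)) (frechet_derivative h (at z) v))) (at z)"
    by (rule has_derivative_compose[OF h smooth_on_has_derivative[OF assms(3) hz]])
  then have "((\<lambda>z. z) has_derivative (\<lambda>v. frechet_derivative k (at (h z)) (frechet_derivative h (at z) v))) (at z)"
    by (rule has_derivative_transform_within_open[OF _ assms(2) z]) (use assms(6) in auto)
  then have "frechet_derivative k (at (h z)) (frechet_derivative h (at z) v) = v" for v
    by (metis has_derivative_unique has_derivative_ident)
  moreover have "frechet_derivative k (at (h z)) 0 = 0"
    by (rule linear_0[OF has_derivative_linear[OF smooth_on_has_derivative[OF assms(3) hz]]])
  ultimately have "frechet_derivative h (at z) v = 0 \<Longrightarrow> v = 0" for v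
    by metis
  then have "tot_real (\<lambda>v. frechet_derivative K (at (h z)) (frechet_derivative h (at z) v))"
    by (rule tot_real_compose[OF assms(8)])
  then show ?thesis
    using frechet_derivative_at[OF has_derivative_compose[OF h smooth_on_has_derivative[OF assms(4) hz]]]
    by simp
qed

lemma derivative_near_incl:
  fixes g :: "real ^ 'n \<Rightarrow> complex ^ 'n"
  assumes "smooth_on W g" and "open W" and "0 \<in> W" and "frechet_derivative g (at 0) = incl"
  obtains r where "0 < r"
    and "\<And>y v. norm y < r \<Longrightarrow> norm (frechet_derivative g (at y) v - incl v) \<le> norm v / 4"
proof -
  \<comment> \<open>Smoothness gives continuity of the derivative only in each fixed direction; the
    sum over the basis is continuous and dominates the operator norm of the difference.\<close>
  define e where "e y = (\<Sum>b\<in>Basis. norm (frechet_derivative g (at y) b - incl b))" for y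
  have "continuous_on W e"
    unfolding e_def
    by (intro continuous_intros smooth_on_continuous_derivative assms(1))
  then have "isCont e 0"
    using assms(2,3) by (simp add: continuous_on_eq_continuous_at)
  moreover have "e 0 = 0" by (simp add: e_def assms(4))
  ultimately have "(e \<longlongrightarrow> 0) (at 0)"
    by (simp add: isCont_def)
  then have "eventually (\<lambda>y. e y < 1 / 4) (at 0)"
    by (rule order_tendstoD) simp
  then have "eventually (\<lambda>y. e y < 1 / 4) (nhds 0)"
    using \<open>e 0 = 0\<close> by (simp add: eventually_nhds_conv_at)
  moreover have "eventually (\<lambda>y. y \<in> W) (nhds 0)"
    using assms(2,3) by (simp add: eventually_nhds_in_open)
  ultimately have "eventually (\<lambda>y. e y < 1 / 4 \<and> y \<in> W) (nhds 0)"
    by (rule eventually_conj)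
  then obtain r where r: "0 < r" "\<And>y. norm y < r \<Longrightarrow> e y < 1 / 4 \<and> y \<in> W"
    by (auto simp: eventually_nhds_metric)
  show thesis
  proof
    show "norm (frechet_derivative g (at y) v - incl v) \<le> norm v / 4" if "norm y < r" for y v
    proof -
      let ?D = "frechet_derivative g (at y)"
      have "linear ?D"
        using r(2)[OF that] smooth_on_has_derivative[OF assms(1)] has_derivative_linear by blast
      then have "?D v - incl v = (\<Sum>b\<in>Basis. (v \<bullet> b) *\<^sub>R (?D b - incl b))"
        using linear_expand[of ?D v] linear_expand[OF linear_incl, of v]
        by (simp add: scaleR_diff_right sum_subtractf)
      also have "norm \<dots> \<le> (\<Sum>b\<in>Basis. norm v * norm (?D b - incl b))"
        by (rule sum_norm_le) (auto intro!: mult_right_mono Basis_le_norm)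
      also have "\<dots> = norm v * e y"
        by (simp add: e_def sum_distrib_left)
      also have "\<dots> \<le> norm v * (1 / 4)"
        using r(2)[OF that] by (intro mult_left_mono) auto
      finally show ?thesis by simp
    qed
  qed (rule r(1))
qed

text \<open>
  The sign \<open>\<sigma>\<close> is 1 on the first manifold. Seen from the second one, the same map is
  \<open>\<i> * neck (- 1) a g\<^sub>2 g\<^sub>1\<close>.
\<close>

definition neck :: "real \<Rightarrow> (real \<Rightarrow> real) \<Rightarrow> (real ^ 'n \<Rightarrow> complex ^ 'n) \<Rightarrow>
    (real ^ 'n \<Rightarrow> complex ^ 'n) \<Rightarrow> real ^ 'n \<Rightarrow> complex ^ 'n" where
  "neck \<sigma> a g\<^sub>1 g\<^sub>2 x = g\<^sub>1 (radial a x) + \<sigma> *\<^sub>R J (g\<^sub>2 (radial (\<lambda>t. a (1 - t)) x))"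

lemma radial_profile_nonneg: "radial_profile r a a' \<Longrightarrow> 0 \<le> a t"
  unfolding radial_profile_def by (cases "t \<le> 1/3") (auto simp: not_le less_imp_le)

lemma neck_smooth_tot_real:
  fixes g\<^sub>1 g\<^sub>2 :: "real ^ 'n \<Rightarrow> complex ^ 'n"
  assumes a: "radial_profile r a a'" and \<sigma>: "\<sigma> * \<sigma> = 1"
    and g1: "smooth_on (ball 0 1) g\<^sub>1" "\<And>y. y \<in> ball 0 1 \<Longrightarrow> tot_real (frechet_derivative g\<^sub>1 (at y))"
      "\<And>y v. norm y < r \<Longrightarrow> norm (frechet_derivative g\<^sub>1 (at y) v - incl v) \<le> norm v / 4"
    and g2: "smooth_on (ball 0 1) g\<^sub>2" "\<And>y. y \<in> ball 0 1 \<Longrightarrow> tot_real (frechet_derivative g\<^sub>2 (at y))"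
      "\<And>y v. norm y < r \<Longrightarrow> norm (frechet_derivative g\<^sub>2 (at y) v - incl v) \<le> norm v / 4"
  shows "smooth_on (ball 0 1 - {0}) (neck \<sigma> a g\<^sub>1 g\<^sub>2)"
    and "\<And>x. x \<in> ball 0 1 - {0} \<Longrightarrow> tot_real (frechet_derivative (neck \<sigma> a g\<^sub>1 g\<^sub>2) (at x))"
proof -
  let ?A = "radial a :: real ^ 'n \<Rightarrow> _" and ?B = "radial (\<lambda>t. a (1 - t)) :: real ^ 'n \<Rightarrow> _"
  have a_smooth: "smooth_on UNIV a" and a_deriv: "\<And>t. (a has_real_derivative a' t) (at t)"
    and a0: "\<And>t. t \<le> 1/3 \<Longrightarrow> a t = 0" "\<And>t. t \<le> 1/3 \<Longrightarrow> a' t = 0"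
    and a_pos: "\<And>t. 1/3 < t \<Longrightarrow> 0 < a t" "\<And>t. 1/3 < t \<Longrightarrow> 0 < a' t"
    and a_r: "\<And>t. t \<le> 2/3 \<Longrightarrow> a t < r" and a_1: "\<And>t. t < 1 \<Longrightarrow> a t < 1"
    using a unfolding radial_profile_def by auto
  have b_smooth: "smooth_on UNIV (\<lambda>t. a (1 - t))"
    by (rule smooth_on_compose[OF smooth_on_diff a_smooth]) auto
  have b_deriv: "((\<lambda>t. a (1 - t)) has_real_derivative - a' (1 - t)) (at t)" for t
    by (rule DERIV_cong[OF DERIV_chain2[where f=a and g="\<lambda>t. 1 - t" and Db="- 1", OF a_deriv]])
       (auto intro!: derivative_eq_intros)
  have A_ball: "?A x \<in> ball 0 1" and B_ball: "?B x \<in> ball 0 1" if "x \<in> ball 0 1 - {0}" for x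
    using that a_1[of "norm x"] a_1[of "1 - norm x"] radial_profile_nonneg[OF a]
    by (auto simp: norm_radial)
  have "smooth_on (ball 0 1 - {0}) (\<lambda>x. g\<^sub>1 (?A x))"
    by (rule smooth_on_compose[OF smooth_on_mono[OF smooth_on_radial[OF a_smooth]] g1(1)
          image_subsetI[OF A_ball]]) auto
  moreover have "smooth_on (ball 0 1 - {0}) (\<lambda>x. g\<^sub>2 (?B x))"
    by (rule smooth_on_compose[OF smooth_on_mono[OF smooth_on_radial[OF b_smooth]] g2(1)
          image_subsetI[OF B_ball]]) auto
  ultimately show "smooth_on (ball 0 1 - {0}) (neck \<sigma> a g\<^sub>1 g\<^sub>2)"
    unfolding neck_def
    by (intro smooth_on_add smooth_on_linear[OF bounded_linear_scaleR_right]
        smooth_on_linear[OF bounded_linear_J]) auto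
  fix x :: "real ^ 'n"
  assume x: "x \<in> ball 0 1 - {0}"
  define t where "t = norm x"
  define u where "u = sgn x"
  have t: "0 < t" "t < 1" using x by (auto simp: t_def)
  have u: "norm u = 1" using x by (simp add: u_def norm_sgn)
  define P where "P = radial_deriv (a' t) (a t / t) u"
  \<comment> \<open>The reflected profile decreases, so the radial eigenvalue is negative; only its
    being nonzero matters for injectivity.\<close>
  define Q where "Q = radial_deriv (- a' (1 - t)) (a (1 - t) / t) u"
  define D1 where "D1 = frechet_derivative g\<^sub>1 (at (?A x))"
  define D2 where "D2 = frechet_derivative g\<^sub>2 (at (?B x))"
  have D1: "(g\<^sub>1 has_derivative D1) (at (?A x))" and D2: "(g\<^sub>2 has_derivative D2) (at (?B x))"
    unfolding D1_def D2_def using A_ball[OF x] B_ball[OF x]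
    by (auto intro: smooth_on_has_derivative g1(1) g2(1))
  have "(?A has_derivative P) (at x)" "(?B has_derivative Q) (at x)"
    unfolding P_def Q_def t_def u_def using x
    by (auto intro: radial_has_derivative a_deriv radial_has_derivative[OF _ b_deriv])
  then have "(neck \<sigma> a g\<^sub>1 g\<^sub>2 has_derivative (\<lambda>v. D1 (P v) + \<sigma> *\<^sub>R J (D2 (Q v)))) (at x)"
    unfolding neck_def using D1 D2
    by (auto intro!: has_derivative_add has_derivative_scaleR_right has_derivative_compose[where g=g\<^sub>1]
        bounded_linear.has_derivative[OF bounded_linear_J] has_derivative_compose[where g=g\<^sub>2])
  then have deriv: "frechet_derivative (neck \<sigma> a g\<^sub>1 g\<^sub>2) (at x) = (\<lambda>v. D1 (P v) + \<sigma> *\<^sub>R J (D2 (Q v)))"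
    by (simp add: frechet_derivative_at[symmetric])
  have lin0: "D1 0 = 0" "D2 0 = 0"
    using D1 D2 has_derivative_linear linear_0 by blast+
  have \<sigma>0: "\<sigma> \<noteq> 0" using \<sigma> by auto
  \<comment> \<open>The first radial map is locally constant in the inner region, the second one in
    the outer region, so a single totally real summand remains there.\<close>
  consider "t \<le> 1/3" | "1/3 < t" "t < 2/3" | "2/3 \<le> t" by linarith
  then show "tot_real (frechet_derivative (neck \<sigma> a g\<^sub>1 g\<^sub>2) (at x))"
  proof cases
    case 1
    have "P v = 0" for v
      using a0[OF 1] by (simp add: P_def radial_deriv_def)
    moreover have "v = 0" if "Q v = 0" for v
      using radial_deriv_inj[OF u _ _ that[unfolded Q_def]] a_pos[of "1 - t"] 1 t by force
    then have "tot_real (\<lambda>v. \<sigma> *\<^sub>R J (D2 (Q v)))"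
      using \<sigma>0 g2(2)[OF B_ball[OF x]] unfolding D2_def
      by (intro tot_real_post[where L="\<lambda>v. \<sigma> *\<^sub>R J v"] tot_real_compose[where P=Q])
         (auto simp: J_scaleR J_add scaleR_add_right intro!: linearI)
    ultimately show ?thesis
      by (simp add: deriv lin0)
  next
    case 2
    \<comment> \<open>Both t and 1 - t are below 2/3 here, so the bound of the profile applies to
      both.\<close>
    have "norm (?A x) < r" "norm (?B x) < r"
      using 2 x a_r[of t] a_r[of "1 - t"] radial_profile_nonneg[OF a] by (auto simp: norm_radial t_def)
    moreover have "v = 0" if "P v = 0" for v
      using radial_deriv_inj[OF u _ _ that[unfolded P_def]] a_pos[of t] 2 t by force
    ultimately show ?thesis
      unfolding deriv D1_def D2_def
      by (intro tot_real_neck g1(3) g2(3) \<sigma>) (auto simp: P_def Q_def intro: radial_deriv_sym[OF u])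
  next
    case 3
    have "Q v = 0" for v
      using a0[of "1 - t"] 3 by (simp add: Q_def radial_deriv_def)
    moreover have "v = 0" if "P v = 0" for v
      using radial_deriv_inj[OF u _ _ that[unfolded P_def]] a_pos[of t] 3 t by force
    then have "tot_real (\<lambda>v. D1 (P v))"
      using g1(2)[OF A_ball[OF x]] unfolding D1_def by (intro tot_real_compose[where P=P])
    ultimately show ?thesis
      by (simp add: deriv lin0)
  qed
qed

text \<open>The complexification \<open>D'\<close> of \<open>D\<close> is injective by total
  reality, hence bijective for reasons of dimension, and it commutes with \<open>J\<close>. Its
  inverse is the required complex automorphism.\<close>

lemma tot_real_normalise:
  fixes D :: "real ^ 'n \<Rightarrow> complex ^ 'n"
  assumes "linear D" and "tot_real D"
  obtains L :: "complex ^ 'n \<Rightarrow> complex ^ 'n" where "linear L" and "\<And>v. L (J v) = J (L v)"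
    and "\<And>v. L v = 0 \<Longrightarrow> v = 0" and "\<And>v. L (D v) = incl v"
proof -
  define re im :: "complex ^ 'n \<Rightarrow> real ^ 'n" where "re z = (\<chi> k. Re (z $ k))" and "im z = (\<chi> k. Im (z $ k))" for z
  define D' where "D' z = D (re z) + J (D (im z))" for z
  have ri: "linear re" "linear im"
    by (auto intro!: linearI simp: re_def im_def vec_eq_iff)
  have "linear D'"
    unfolding D'_def
    by (intro linear_compose_add linear_compose[unfolded o_def, OF ri(1) assms(1)]
        linear_compose[unfolded o_def, OF linear_compose[unfolded o_def, OF ri(2) assms(1)] linear_J])
  moreover have "z = 0" if "D' z = 0" for z
  proof -
    have "re z = 0" "im z = 0"
      using that assms(2) unfolding D'_def tot_real_def by blast+
    then show ?thesis by (simp add: re_def im_def vec_eq_iff complex_eq_iff)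
  qed
  ultimately have inj: "inj D'" by (simp add: linear_injective_0)
  obtain L where L: "linear L" "\<And>z. L (D' z) = z"
    using linear_injective_left_inverse[OF \<open>linear D'\<close> inj] by (auto simp: fun_eq_iff)
  have surj: "\<exists>z. v = D' z" for v
    using linear_inj_imp_surj[OF \<open>linear D'\<close> inj] by auto
  have D'_J: "D' (J z) = J (D' z)" for z
  proof -
    have "re (J z) = - im z" "im (J z) = re z"
      by (simp_all add: re_def im_def J_def vec_eq_iff)
    then show ?thesis
      by (simp add: D'_def J_add J_J linear_neg[OF assms(1)])
  qed
  show thesis
  proof
    show "L (J v) = J (L v)" for v
      using surj[of v] L(2) D'_J by metis
    show "v = 0" if "L v = 0" for v
      using surj[of v] L(2) that linear_0[OF \<open>linear D'\<close>] by metis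
    show "L (D v) = incl v" for v
    proof -
      have "re (incl v) = v" "im (incl v) = 0"
        by (simp_all add: re_def im_def incl_def vec_eq_iff)
      then have "D' (incl v) = D v"
        by (simp add: D'_def linear_0[OF assms(1)])
      then show ?thesis using L(2) by metis
    qed
  qed (rule L(1))
qed

section \<open>Totally real maps on manifolds\<close>

definition totally_real_on :: "('a, 'n::finite) oriented_manifold \<Rightarrow> 'a set \<Rightarrow> ('a \<Rightarrow> complex ^ 'n) \<Rightarrow> bool" where
  "totally_real_on M S f \<longleftrightarrow> (\<forall>(U, \<phi>) \<in> charts M. smooth_on (\<phi> ` (U \<inter> S)) (f \<circ> inv_into U \<phi>) \<and>
     (\<forall>x \<in> U \<inter> S. tot_real (frechet_derivative (f \<circ> inv_into U \<phi>) (at (\<phi> x)))))"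

text \<open>A kernel vector v + iw of the complexification says D v = J (D (-w)), which is a common
  vector of the range and its image under \<open>J\<close>.\<close>

lemma tot_real_iff:
  assumes "linear D"
  shows "tot_real D \<longleftrightarrow> inj D \<and> range D \<inter> J ` range D = {0}"
proof
  assume D: "tot_real D"
  have "inj D"
    using tot_real_inj[OF assms D] by (simp add: linear_injective_0[OF assms])
  moreover have "x = 0" if x: "x \<in> range D" "x \<in> J ` range D" for x
  proof -
    obtain v where "x = D v" using x by blast
    moreover obtain w where "x = J (D w)" using x by blast
    ultimately have "D v + J (D (- w)) = 0" by (simp add: linear_neg[OF assms] J_minus)
    then show ?thesis
      using D \<open>x = D v\<close> linear_0[OF assms] unfolding tot_real_def by metis
  qed
  moreover have "0 \<in> range D" using linear_0[OF assms] by (metis rangeI)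
  moreover have "0 \<in> J ` range D" using linear_0[OF assms] J_0 by (metis rangeI imageI)
  ultimately show "inj D \<and> range D \<inter> J ` range D = {0}" by blast
next
  assume D: "inj D \<and> range D \<inter> J ` range D = {0}"
  have inj: "v = 0" if "D v = 0" for v
    using D that by (simp add: linear_injective_0[OF assms])
  show "tot_real D"
    unfolding tot_real_def
  proof (intro allI impI)
    fix v w assume "D v + J (D w) = 0"
    then have "D v = J (D (- w))" by (simp add: linear_neg[OF assms] J_minus eq_neg_iff_add_eq_0)
    then have "D v \<in> range D \<inter> J ` range D" by (metis IntI rangeI imageI)
    then have "D v = 0" using D by blast
    moreover then have "D w = 0" using \<open>D v + J (D w) = 0\<close> by simp
    ultimately show "v = 0 \<and> w = 0" using inj by blast
  qed
qed

lemma totally_real_immersion_iff: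
  fixes M :: "('a, 'n::finite) oriented_manifold"
  shows "totally_real_immersion M f \<longleftrightarrow> totally_real_on M UNIV f"
proof -
  define sm where "sm p \<longleftrightarrow> smooth_on (snd p ` fst p) (f \<circ> inv_into (fst p) (snd p))"
    for p :: "'a set \<times> ('a \<Rightarrow> real ^ 'n)"
  define tr where "tr p x \<longleftrightarrow> tot_real (frechet_derivative (f \<circ> inv_into (fst p) (snd p)) (at (snd p x)))"
    for p :: "'a set \<times> ('a \<Rightarrow> real ^ 'n)" and x
  define ir where "ir p x \<longleftrightarrow> inj (differential p f x) \<and>
      range (differential p f x) \<inter> J ` range (differential p f x) = {0}" for p x
  \<comment> \<open>Smoothness is assumed because \<open>tot_real_iff\<close> needs the differential
    to be linear, and \<open>frechet_derivative\<close> guarantees this only for differentiable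
    maps.\<close>
  have *: "ir p x \<longleftrightarrow> tr p x" if "sm p" "x \<in> fst p" for p x
    using tot_real_iff[OF has_derivative_linear[OF
        smooth_on_has_derivative[OF that(1)[unfolded sm_def] imageI[OF that(2)]]]]
    by (simp add: ir_def differential_def tr_def case_prod_unfold)
  have "totally_real_on M UNIV f \<longleftrightarrow> (\<forall>p\<in>charts M. sm p \<and> (\<forall>x\<in>fst p. tr p x))"
    by (simp add: totally_real_on_def sm_def tr_def case_prod_unfold)
  also have "\<dots> \<longleftrightarrow> (\<forall>p\<in>charts M. sm p) \<and> (\<forall>p\<in>charts M. \<forall>x\<in>fst p. ir p x)"
    using * by blast
  also have "\<dots> \<longleftrightarrow> totally_real_immersion M f"
    unfolding totally_real_immersion_def immersion_def smooth_map_def sm_def ir_def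
    by (simp add: case_prod_unfold ball_conj_distrib conj_assoc)
  finally show ?thesis by simp
qed

lemma totally_real_on_linear:
  fixes L :: "complex ^ 'n::finite \<Rightarrow> complex ^ 'n"
  assumes f: "totally_real_on M S f" and L: "linear L" "\<And>v. L (J v) = J (L v)" "\<And>v. L v = 0 \<Longrightarrow> v = 0"
    and op: "\<And>U \<phi>. (U, \<phi>) \<in> charts M \<Longrightarrow> open (\<phi> ` (U \<inter> S))"
  shows "totally_real_on M S (\<lambda>y. L (f y - c))"
  unfolding totally_real_on_def
proof (intro ballI case_prodI2 conjI)
  fix p U \<phi> assume p: "p \<in> charts M" "p = (U, \<phi>)"
  have bl: "bounded_linear L" using L(1) by (simp add: linear_conv_bounded_linear)
  have sm: "smooth_on (\<phi> ` (U \<inter> S)) (f \<circ> inv_into U \<phi>)"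
    using f p unfolding totally_real_on_def by auto
  show "smooth_on (\<phi> ` (U \<inter> S)) ((\<lambda>y. L (f y - c)) \<circ> inv_into U \<phi>)"
    using sm op p unfolding o_def by (intro smooth_on_linear[OF bl] smooth_on_diff) auto
  fix x assume x: "x \<in> U \<inter> S"
  let ?D = "frechet_derivative (f \<circ> inv_into U \<phi>) (at (\<phi> x))"
  have "((f \<circ> inv_into U \<phi>) has_derivative ?D) (at (\<phi> x))"
    by (rule smooth_on_has_derivative[OF sm imageI[OF x]])
  then have "((\<lambda>z. L ((f \<circ> inv_into U \<phi>) z - c)) has_derivative (\<lambda>v. L (?D v - 0))) (at (\<phi> x))"
    by (intro bounded_linear.has_derivative[OF bl] has_derivative_diff has_derivative_const)
  then have "frechet_derivative ((\<lambda>y. L (f y - c)) \<circ> inv_into U \<phi>) (at (\<phi> x)) = (\<lambda>v. L (?D v))"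
    by (simp add: o_def frechet_derivative_at[symmetric])
  moreover have "tot_real ?D"
    using f p x unfolding totally_real_on_def by blast
  ultimately show "tot_real (frechet_derivative ((\<lambda>y. L (f y - c)) \<circ> inv_into U \<phi>) (at (\<phi> x)))"
    using tot_real_post L by auto
qed

text \<open>The facts about atlas and disc that are shared by the first manifold and the opposite of
  the second. They are verified for the opposite directly, without establishing all of
  \<open>closed_oriented_manifold\<close> for it.\<close>

locale disc_in_manifold =
  fixes M :: "('a, 'n::finite) oriented_manifold" and W :: "(real ^ 'n) set" and i :: "real ^ 'n \<Rightarrow> 'a"
  assumes hausdorff: "Hausdorff_space (top_of M)"
    and chart: "\<And>U \<phi>. (U, \<phi>) \<in> charts M \<Longrightarrow> openin (top_of M) U"
      "\<And>U \<phi>. (U, \<phi>) \<in> charts M \<Longrightarrow> inj_on \<phi> U"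
      "\<And>U \<phi> V. (U, \<phi>) \<in> charts M \<Longrightarrow> openin (top_of M) V \<Longrightarrow> open (\<phi> ` (U \<inter> V))"
    and cover: "(\<Union>c \<in> charts M. fst c) = topspace (top_of M)"
    and emb: "open_embedding M W i"
    and cball: "cball 0 1 \<subseteq> W"
begin

lemma open_W: "open W"
  using emb by (simp add: open_embedding_def)

lemma inj_i: "inj_on i W"
  using emb by (auto simp: open_embedding_def homeomorphic_map_def)

lemma ball_W: "ball 0 1 \<subseteq> W"
  using cball ball_subset_cball by blast

lemma zero_W: "0 \<in> W"
  using cball by auto

lemma i_topspace: "x \<in> W \<Longrightarrow> i x \<in> topspace (top_of M)"
  using emb openin_subset by (fastforce simp: open_embedding_def)

lemma openin_image:
  assumes "open T" "T \<subseteq> W"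
  shows "openin (top_of M) (i ` T)"
proof -
  have "open_map (top_of_set W) (subtopology (top_of M) (i ` W)) i"
    using emb homeomorphic_imp_open_map by (auto simp: open_embedding_def)
  then have "openin (subtopology (top_of M) (i ` W)) (i ` T)"
    using assms open_W unfolding open_map_def by (metis openin_open_eq)
  then show ?thesis
    using emb by (auto simp: open_embedding_def intro: openin_trans_full)
qed

lemma continuous_i: "continuous_map (top_of_set W) (top_of M) i"
  using emb homeomorphic_imp_continuous_map continuous_map_in_subtopology
  by (fastforce simp: open_embedding_def)

lemma open_vimage: "openin (top_of M) U \<Longrightarrow> open (W \<inter> i -` U)"
  using openin_continuous_map_preimage[OF continuous_i, of U] open_W
  by (simp add: openin_open_eq vimage_def Int_def)

text \<open>Compact sets in Hausdorff spaces are closed. Radius 5/6 makes the region outside of the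
  neck open, radius 0 the punctured manifold.\<close>

lemma closedin_image_cball: "s \<le> 1 \<Longrightarrow> closedin (top_of M) (i ` cball 0 s)"
proof (rule compactin_imp_closedin[OF hausdorff])
  assume "s \<le> 1"
  then have "compactin (top_of_set W) (cball 0 s)"
    using cball by (auto simp: compactin_subtopology)
  then show "compactin (top_of M) (i ` cball 0 s)"
    using continuous_i image_compactin by blast
qed

lemma inv_i: "x \<in> W \<Longrightarrow> inv_into W i (i x) = x"
  using inj_i by simp

lemma chart_i_smooth:
  assumes "(U, \<phi>) \<in> charts M"
  shows "smooth_on (W \<inter> i -` U) (\<lambda>x. \<phi> (i x))"
    and "smooth_on (\<phi> ` (U \<inter> i ` W)) (\<lambda>z. inv_into W i (inv_into U \<phi> z))"
  using emb assms unfolding open_embedding_def by (auto simp: o_def)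

text \<open>Near each point \<open>f \<circ> i\<close> is the coordinate expression of
  \<open>f\<close> after \<open>\<phi> \<circ> i\<close>, which has a smooth inverse because
  \<open>i\<close> is an open embedding.\<close>

lemma pull_back:
  assumes f: "totally_real_on M UNIV f"
  shows "smooth_on W (f \<circ> i)" and "\<And>x. x \<in> W \<Longrightarrow> tot_real (frechet_derivative (f \<circ> i) (at x))"
proof -
  have *: "\<exists>T. open T \<and> x \<in> T \<and> smooth_on (W \<inter> T) (f \<circ> i) \<and> tot_real (frechet_derivative (f \<circ> i) (at x))"
    if x: "x \<in> W" for x
  proof -
    obtain U \<phi> where U: "(U, \<phi>) \<in> charts M" "i x \<in> U"
      using cover i_topspace[OF x] by fastforce
    let ?T = "W \<inter> i -` U" and ?g = "f \<circ> inv_into U \<phi>"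
    have T: "open ?T" "x \<in> ?T" using open_vimage[OF chart(1)[OF U(1)]] x U by auto
    have g: "smooth_on (\<phi> ` U) ?g" "tot_real (frechet_derivative ?g (at (\<phi> (i x))))"
      using f U unfolding totally_real_on_def by auto
    have inv: "inv_into U \<phi> (\<phi> y) = y" if "y \<in> U" for y
      using chart(2)[OF U(1)] that by simp
    have eq: "?g (\<phi> (i y)) = (f \<circ> i) y" if "y \<in> ?T" for y
      using that inv by simp
    have "smooth_on ?T (\<lambda>y. ?g (\<phi> (i y)))"
      by (rule smooth_on_compose[OF chart_i_smooth(1)[OF U(1)] g(1)]) (use T in auto)
    then have "smooth_on ?T (f \<circ> i)"
      by (rule smooth_on_cong[OF T(1)]) (rule eq)
    moreover have g': "tot_real (frechet_derivative (\<lambda>y. ?g (\<phi> (i y))) (at x))"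
    proof (rule tot_real_derivative_compose[OF chart_i_smooth(1)[OF U(1)] T(1)
          chart_i_smooth(2)[OF U(1)] _ _ _ T(2) g(2)])
      show "smooth_on (\<phi> ` (U \<inter> i ` W)) ?g"
        using g(1) by (rule smooth_on_mono) auto
    qed (auto simp: inv inv_i)
    have "(\<lambda>y. ?g (\<phi> (i y))) differentiable (at x)"
      using smooth_on_has_derivative[OF \<open>smooth_on ?T (\<lambda>y. ?g (\<phi> (i y)))\<close> T(2)]
      by (auto simp: differentiable_def)
    then have "frechet_derivative (\<lambda>y. ?g (\<phi> (i y))) (at x) = frechet_derivative (f \<circ> i) (at x)"
      by (rule frechet_derivative_transform_within_open[OF _ T]) (rule eq)
    ultimately show ?thesis
      using T g' by (intro exI[of _ ?T]) simp
  qed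
  show "smooth_on W (f \<circ> i)"
    by (rule smooth_on_local) (use * in blast)
  show "\<And>x. x \<in> W \<Longrightarrow> tot_real (frechet_derivative (f \<circ> i) (at x))"
    using * by blast
qed

text \<open>The converse transfer, from disc coordinates to charts. It is stated for open subsets
  \<open>T\<close> because the neck lives on the punctured ball only.\<close>

lemma push_forward:
  assumes T: "open T" "T \<subseteq> W" and K: "smooth_on T K" "\<And>x. x \<in> T \<Longrightarrow> tot_real (frechet_derivative K (at x))"
    and F: "\<And>x. x \<in> T \<Longrightarrow> F (i x) = K x" and U: "(U, \<phi>) \<in> charts M"
  shows "smooth_on (\<phi> ` (U \<inter> i ` T)) (F \<circ> inv_into U \<phi>)"
    and "\<And>x. x \<in> U \<inter> i ` T \<Longrightarrow> tot_real (frechet_derivative (F \<circ> inv_into U \<phi>) (at (\<phi> x)))"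
proof -
  let ?S = "\<phi> ` (U \<inter> i ` T)" and ?h = "\<lambda>z. inv_into W i (inv_into U \<phi> z)"
  have S: "open ?S" using chart(3)[OF U openin_image[OF T]] .
  have inv: "inv_into U \<phi> (\<phi> y) = y" if "y \<in> U" for y
    using chart(2)[OF U] that by simp
  have h: "smooth_on ?S ?h"
    by (rule smooth_on_mono[OF chart_i_smooth(2)[OF U]]) (use T in auto)
  have hT: "?h ` ?S \<subseteq> T"
    using T by (auto simp: inv) (metis inv_i subsetD)
  \<comment> \<open>On this smaller set \<open>\<phi> \<circ> i\<close> makes sense and serves as
    the smooth left inverse of \<open>?h\<close>.\<close>
  have hT': "?h ` ?S \<subseteq> T \<inter> i -` U"
    using hT T by (auto simp: inv) (metis inv_i subsetD)
  have eq: "K (?h z) = (F \<circ> inv_into U \<phi>) z" if "z \<in> ?S" for z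
  proof -
    obtain x where "z = \<phi> (i x)" "x \<in> T" "i x \<in> U" using \<open>z \<in> ?S\<close> by auto
    then show ?thesis using T F by (auto simp: inv) (metis inv_i subsetD)
  qed
  have Kh: "smooth_on ?S (\<lambda>z. K (?h z))"
    by (rule smooth_on_compose[OF h K(1) hT S])
  then show "smooth_on ?S (F \<circ> inv_into U \<phi>)"
    by (rule smooth_on_cong[OF S]) (rule eq)
  fix x assume x: "x \<in> U \<inter> i ` T"
  then have z: "\<phi> x \<in> ?S" by simp
  have "tot_real (frechet_derivative (\<lambda>z. K (?h z)) (at (\<phi> x)))"
  proof (rule tot_real_derivative_compose[OF h S _ _ hT' _ z])
    show "smooth_on (T \<inter> i -` U) (\<lambda>x. \<phi> (i x))"
      by (rule smooth_on_mono[OF chart_i_smooth(1)[OF U]]) (use T in auto)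
    show "smooth_on (T \<inter> i -` U) K"
      by (rule smooth_on_mono[OF K(1)]) auto
    show "\<phi> (i (?h y)) = y" if "y \<in> ?S" for y
      using that T by (auto simp: inv) (metis inv_i subsetD)
    show "tot_real (frechet_derivative K (at (?h (\<phi> x))))"
      using hT z by (intro K(2)) blast
  qed
  moreover have "(\<lambda>z. K (?h z)) differentiable (at (\<phi> x))"
    using smooth_on_has_derivative[OF Kh z] by (auto simp: differentiable_def)
  then have "frechet_derivative (\<lambda>z. K (?h z)) (at (\<phi> x)) = frechet_derivative (F \<circ> inv_into U \<phi>) (at (\<phi> x))"
    by (rule frechet_derivative_transform_within_open[OF _ S z]) (rule eq)
  ultimately show "tot_real (frechet_derivative (F \<circ> inv_into U \<phi>) (at (\<phi> x)))"
    by simp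
qed

lemma normalise:
  assumes f: "totally_real_on M UNIV f"
  obtains f' where "totally_real_on M UNIV f'" and "f' (i 0) = 0"
    and "frechet_derivative (f' \<circ> i) (at 0) = incl"
proof -
  let ?D = "frechet_derivative (f \<circ> i) (at 0)"
  have D: "((f \<circ> i) has_derivative ?D) (at 0)"
    by (rule smooth_on_has_derivative[OF pull_back(1)[OF f] zero_W])
  obtain L :: "complex ^ 'n \<Rightarrow> complex ^ 'n" where L: "linear L" "\<And>v. L (J v) = J (L v)"
    "\<And>v. L v = 0 \<Longrightarrow> v = 0" "\<And>v. L (?D v) = incl v"
    using tot_real_normalise[OF has_derivative_linear[OF D] pull_back(2)[OF f zero_W]] by blast
  show thesis
  proof
    show "totally_real_on M UNIV (\<lambda>y. L (f y - f (i 0)))"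
    proof (rule totally_real_on_linear[OF f L(1-3)])
      fix U \<phi> assume U: "(U, \<phi>) \<in> charts M"
      show "open (\<phi> ` (U \<inter> UNIV))"
        using chart(3)[OF U openin_topspace] openin_subset[OF chart(1)[OF U]]
        by (simp add: Int_absorb2)
    qed
    show "L (f (i 0) - f (i 0)) = 0"
      by (simp add: linear_0[OF L(1)])
    have "((\<lambda>z. L ((f \<circ> i) z - f (i 0))) has_derivative (\<lambda>v. L (?D v - 0))) (at 0)"
      using L(1) D by (intro bounded_linear.has_derivative[of L] has_derivative_diff has_derivative_const)
        (simp_all add: linear_conv_bounded_linear o_def)
    then show "frechet_derivative ((\<lambda>y. L (f y - f (i 0))) \<circ> i) (at 0) = incl"
      by (simp add: o_def frechet_derivative_at[symmetric] L(4)[unfolded o_def] fun_eq_iff)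
  qed
qed

definition attach :: "real \<Rightarrow> (real \<Rightarrow> real) \<Rightarrow> ('a \<Rightarrow> complex ^ 'n) \<Rightarrow> (real ^ 'n \<Rightarrow> complex ^ 'n) \<Rightarrow> 'a \<Rightarrow> complex ^ 'n" where
  "attach \<sigma> a f g y =
     (if y \<in> i ` (ball 0 1 - {0}) then neck \<sigma> a (f \<circ> i) g (inv_into W i y) else f y)"

lemma attach_disc: "x \<in> ball 0 1 - {0} \<Longrightarrow> attach \<sigma> a f g (i x) = neck \<sigma> a (f \<circ> i) g x"
  using ball_W inv_i by (auto simp: attach_def)

text \<open>Two open sets cover the punctured manifold: the punctured open disc, where the map is
  the neck, and the complement of the closed disc of radius 5/6, where it is \<open>f\<close>. Both
  conditions are local.\<close>

lemma attach_totally_real: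
  assumes a: "radial_profile r a a'" and \<sigma>: "\<sigma> * \<sigma> = 1"
    and f: "totally_real_on M UNIV f"
      "\<And>y v. norm y < r \<Longrightarrow> norm (frechet_derivative (f \<circ> i) (at y) v - incl v) \<le> norm v / 4"
    and g: "smooth_on (ball 0 1) g" "\<And>y. y \<in> ball 0 1 \<Longrightarrow> tot_real (frechet_derivative g (at y))"
      "\<And>y v. norm y < r \<Longrightarrow> norm (frechet_derivative g (at y) v - incl v) \<le> norm v / 4" "g 0 = 0"
  shows "totally_real_on M (- {i 0}) (attach \<sigma> a f g)"
  unfolding totally_real_on_def
proof (intro ballI case_prodI2)
  fix p U \<phi> assume "p \<in> charts M" "p = (U, \<phi>)"
  then have U: "(U, \<phi>) \<in> charts M" by simp
  let ?F = "attach \<sigma> a f g" and ?B = "ball 0 1 - {0} :: (real ^ 'n) set"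
  let ?N = "i ` ?B" and ?E = "topspace (top_of M) - i ` cball 0 (5/6)"
  let ?G = "?F \<circ> inv_into U \<phi>"
  have inv: "inv_into U \<phi> (\<phi> y) = y" if "y \<in> U" for y
    using chart(2)[OF U] that by simp
  have B: "open ?B" "?B \<subseteq> W" using ball_W by auto
  have N: "smooth_on (\<phi> ` (U \<inter> ?N)) ?G"
    "x \<in> U \<inter> ?N \<Longrightarrow> tot_real (frechet_derivative ?G (at (\<phi> x)))" for x
  proof -
    have "smooth_on (ball 0 1) (f \<circ> i)"
      using pull_back(1)[OF f(1)] ball_W smooth_on_mono by blast
    moreover have "y \<in> ball 0 1 \<Longrightarrow> tot_real (frechet_derivative (f \<circ> i) (at y))" for y
      using pull_back(2)[OF f(1)] ball_W by blast
    ultimately have K: "smooth_on ?B (neck \<sigma> a (f \<circ> i) g)"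
      "\<And>x. x \<in> ?B \<Longrightarrow> tot_real (frechet_derivative (neck \<sigma> a (f \<circ> i) g) (at x))"
      using neck_smooth_tot_real[OF a \<sigma> _ _ f(2) g(1-3)] by blast+
    show "smooth_on (\<phi> ` (U \<inter> ?N)) ?G"
      by (rule push_forward(1)[OF B K attach_disc U])
    show "x \<in> U \<inter> ?N \<Longrightarrow> tot_real (frechet_derivative ?G (at (\<phi> x)))"
      by (rule push_forward(2)[OF B K attach_disc U])
  qed
  have E_open: "openin (top_of M) ?E"
    using closedin_image_cball[of "5/6"] by (intro openin_diff) auto
  \<comment> \<open>Between radii 5/6 and 1 the first radial map is the identity and the second one
    is 0, so \<open>g 0 = 0\<close> leaves just \<open>f\<close>.\<close>
  have F_E: "?F y = f y" if "y \<in> ?E" for y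
  proof (cases "y \<in> ?N")
    case True
    then obtain x where x: "x \<in> ?B" "y = i x" by blast
    then have n: "5/6 < norm x" "norm x < 1" using that by auto
    have "a (norm x) = norm x" "a (1 - norm x) = 0"
      using a n unfolding radial_profile_def by auto
    then have "radial a x = x" "radial (\<lambda>t. a (1 - t)) x = 0"
      using x by (simp_all add: radial_def)
    then show ?thesis
      using attach_disc[OF x(1), of \<sigma> a f g] x(2) g(4) by (simp add: neck_def)
  qed (simp add: attach_def)
  have E: "smooth_on (\<phi> ` (U \<inter> ?E)) ?G"
    "x \<in> U \<inter> ?E \<Longrightarrow> tot_real (frechet_derivative ?G (at (\<phi> x)))" for x
  proof -
    let ?S = "\<phi> ` (U \<inter> ?E)"
    have S: "open ?S" using chart(3)[OF U E_open] .
    have sm: "smooth_on (\<phi> ` U) (f \<circ> inv_into U \<phi>)"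
      and tr: "x \<in> U \<Longrightarrow> tot_real (frechet_derivative (f \<circ> inv_into U \<phi>) (at (\<phi> x)))" for x
      using f(1) U unfolding totally_real_on_def by auto
    have eq: "(f \<circ> inv_into U \<phi>) z = ?G z" if "z \<in> ?S" for z
      using that F_E by (auto simp: inv)
    have sm': "smooth_on ?S (f \<circ> inv_into U \<phi>)"
      using sm by (rule smooth_on_mono) auto
    then show "smooth_on ?S ?G"
      by (rule smooth_on_cong[OF S]) (rule eq)
    show "tot_real (frechet_derivative ?G (at (\<phi> x)))" if x: "x \<in> U \<inter> ?E"
    proof -
      have z: "\<phi> x \<in> ?S" using x by blast
      have "(f \<circ> inv_into U \<phi>) differentiable (at (\<phi> x))"
        using smooth_on_has_derivative[OF sm' z] by (auto simp: differentiable_def)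
      then have "frechet_derivative (f \<circ> inv_into U \<phi>) (at (\<phi> x)) = frechet_derivative ?G (at (\<phi> x))"
        by (rule frechet_derivative_transform_within_open[OF _ S z]) (rule eq)
      then show ?thesis using tr[of x] x by simp
    qed
  qed
  have NE: "x \<in> U \<inter> ?N \<or> x \<in> U \<inter> ?E" if "x \<in> U \<inter> - {i 0}" for x
    using that openin_subset[OF chart(1)[OF U]] by force
  show "smooth_on (\<phi> ` (U \<inter> - {i 0})) ?G \<and>
      (\<forall>x\<in>U \<inter> - {i 0}. tot_real (frechet_derivative ?G (at (\<phi> x))))"
  proof
    show "smooth_on (\<phi> ` (U \<inter> - {i 0})) ?G"
    proof (rule smooth_on_local)
      fix z assume "z \<in> \<phi> ` (U \<inter> - {i 0})"
      then have "z \<in> \<phi> ` (U \<inter> ?N) \<or> z \<in> \<phi> ` (U \<inter> ?E)" using NE by blast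
      then show "\<exists>T. open T \<and> z \<in> T \<and> smooth_on (\<phi> ` (U \<inter> - {i 0}) \<inter> T) ?G"
        using chart(3)[OF U openin_image[OF B]] chart(3)[OF U E_open]
          smooth_on_mono[OF N(1) Int_lower2] smooth_on_mono[OF E(1) Int_lower2] by blast
    qed
    show "\<forall>x\<in>U \<inter> - {i 0}. tot_real (frechet_derivative ?G (at (\<phi> x)))"
    proof
      fix x assume "x \<in> U \<inter> - {i 0}"
      from NE[OF this] show "tot_real (frechet_derivative ?G (at (\<phi> x)))"
        using N(2) E(2) by (rule disjE)
    qed
  qed
qed

lemma open_chart_punctured:
  assumes "(U, \<phi>) \<in> charts M"
  shows "open (\<phi> ` (U \<inter> - {i 0}))"
proof -
  have "openin (top_of M) (topspace (top_of M) - i ` cball 0 0)"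
    by (intro openin_diff openin_topspace closedin_image_cball) simp
  from chart(3)[OF assms this] show ?thesis
    using openin_subset[OF chart(1)[OF assms]] by (simp add: Int_absorb2 Diff_eq Int_assoc[symmetric])
qed

end

section \<open>Opposite orientations and connected sums\<close>

lemma is_chart_open_image:
  assumes "is_chart X (U, \<phi>)"
  shows "openin X U" and "inj_on \<phi> U" and "openin X V \<Longrightarrow> open (\<phi> ` (U \<inter> V))"
proof -
  have U: "openin X U" and op: "open (\<phi> ` U)"
    and h: "homeomorphic_map (subtopology X U) (top_of_set (\<phi> ` U)) \<phi>"
    using assms by (auto simp: is_chart_def)
  have "topspace (subtopology X U) = U"
    using openin_subset[OF U] by (simp add: Int_absorb1)
  with h show "inj_on \<phi> U"
    by (simp add: homeomorphic_map_def)
  show "open (\<phi> ` (U \<inter> V))" if "openin X V"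
  proof -
    have "openin (subtopology X U) (U \<inter> V)"
      using that by (auto simp: openin_subtopology)
    then have "openin (top_of_set (\<phi> ` U)) (\<phi> ` (U \<inter> V))"
      using homeomorphic_imp_open_map[OF h] unfolding open_map_def by blast
    then show ?thesis using op by (simp add: openin_open_eq)
  qed
  show "openin X U" by (rule U)
qed

lemma disc_in_closed_manifold:
  assumes "closed_oriented_manifold M" and "open_embedding M W i" and "cball 0 1 \<subseteq> W"
  shows "disc_in_manifold M W i"
proof
  have ch: "is_chart (top_of M) (U, \<phi>)" if "(U, \<phi>) \<in> charts M" for U \<phi>
    using assms(1) that unfolding closed_oriented_manifold_def by blast
  show "openin (top_of M) U" "inj_on \<phi> U" "openin (top_of M) V \<Longrightarrow> open (\<phi> ` (U \<inter> V))"
    if "(U, \<phi>) \<in> charts M" for U \<phi> V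
    using is_chart_open_image[OF ch[OF that]] by blast+
qed (use assms in \<open>auto simp: closed_oriented_manifold_def\<close>)

lemma opposite_chartE:
  fixes M :: "('a, 'n::finite) oriented_manifold"
  assumes "(U, \<psi>) \<in> charts (opposite M)"
  obtains \<phi> and R R' :: "real ^ 'n ^ 'n" where "(U, \<phi>) \<in> charts M" and "\<psi> = (\<lambda>x. R *v \<phi> x)"
    and "\<And>v. R *v (R' *v v) = v" and "\<And>v. R' *v (R *v v) = v"
proof -
  obtain \<phi> and R :: "real ^ 'n ^ 'n" where R: "(U, \<phi>) \<in> charts M" "\<psi> = (\<lambda>x. R *v \<phi> x)" "det R < 0"
    using assms by (auto simp: opposite_def)
  then obtain R' where "R ** R' = mat 1" "R' ** R = mat 1"
    using invertible_det_nz[of R] by (auto simp: invertible_def)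
  then show thesis
    using R(1,2) that[of \<phi> R R'] by (simp add: matrix_vector_mul_assoc)
qed

lemma open_image_matrix:
  fixes R R' :: "real ^ 'n ^ 'n"
  assumes "\<And>v. R *v (R' *v v) = v" and "\<And>v. R' *v (R *v v) = v" and "open S"
  shows "open ((\<lambda>v. R *v v) ` S)"
proof -
  have "surj (\<lambda>v. R *v v)" using assms(1) by (metis surjI)
  then show ?thesis
    by (intro open_surjective_linear_image[OF assms(3)]) (auto simp: matrix_vector_mul_linear)
qed

lemma disc_in_opposite:
  fixes M :: "('a, 'n::finite) oriented_manifold"
  assumes M: "closed_oriented_manifold M" and emb: "open_embedding (opposite M) W i" "cball 0 1 \<subseteq> W"
  shows "disc_in_manifold (opposite M) W i"
proof
  have top: "top_of (opposite M) = top_of M" by (simp add: opposite_def)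
  have ch: "is_chart (top_of M) (U, \<phi>)" if "(U, \<phi>) \<in> charts M" for U \<phi>
    using M that unfolding closed_oriented_manifold_def by blast
  show "Hausdorff_space (top_of (opposite M))"
    using M by (simp add: top closed_oriented_manifold_def)
  fix U \<psi> assume "(U, \<psi>) \<in> charts (opposite M)"
  then show "openin (top_of (opposite M)) U" "inj_on \<psi> U"
    "openin (top_of (opposite M)) V \<Longrightarrow> open (\<psi> ` (U \<inter> V))" for V
  proof (atomize (full), elim opposite_chartE, intro conjI allI impI)
    fix \<phi> and R R' :: "real ^ 'n ^ 'n"
    assume U: "(U, \<phi>) \<in> charts M" and \<psi>: "\<psi> = (\<lambda>x. R *v \<phi> x)"
      and R: "\<And>v. R *v (R' *v v) = v" "\<And>v. R' *v (R *v v) = v"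
    note * = is_chart_open_image[OF ch[OF U]]
    show "openin (top_of (opposite M)) U" using * by (simp add: top)
    show "inj_on \<psi> U" using *(2) R(2) unfolding \<psi> inj_on_def by metis
    show "open (\<psi> ` (U \<inter> V))" if "openin (top_of (opposite M)) V" for V
      using open_image_matrix[OF R *(3)[of V]] that by (simp add: top \<psi> image_image)
  qed
next
  have "fst ` charts (opposite M) = fst ` charts M"
  proof
    show "fst ` charts (opposite M) \<subseteq> fst ` charts M"
      by (force simp: opposite_def)
    \<comment> \<open>Without an orientation-reversing matrix the opposite atlas would be empty; a
      reflection in one coordinate provides one, as index types are nonempty.\<close>
    have "\<exists>R :: real ^ 'n ^ 'n. det R < 0"
    proof -
      fix k :: 'n
      let ?R = "\<chi> i j. if i = j then if i = k then - 1 else 1 else 0 :: real ^ 'n ^ 'n"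
      have "det ?R = (\<Prod>i\<in>UNIV. if i = k then - 1 else 1)"
        by (subst det_diagonal) auto
      also have "\<dots> = - 1" by simp
      finally have "det ?R < 0" by simp
      then show ?thesis by blast
    qed
    then show "fst ` charts M \<subseteq> fst ` charts (opposite M)"
      unfolding opposite_def by force
  qed
  then show "(\<Union>c\<in>charts (opposite M). fst c) = topspace (top_of (opposite M))"
    using M by (simp add: closed_oriented_manifold_def opposite_def)
qed (use emb in auto)

text \<open>In an opposite chart the coordinate expression of \<open>f\<close> is merely precomposed
  with the real linear isomorphism \<open>R'\<close>, which preserves injectivity of the
  complexified derivative.\<close>

lemma totally_real_on_opposite:
  fixes M :: "('a, 'n::finite) oriented_manifold"
  assumes M: "closed_oriented_manifold M" and f: "totally_real_on M UNIV f"
  shows "totally_real_on (opposite M) UNIV f"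
  unfolding totally_real_on_def
proof (intro ballI case_prodI2)
  fix p U \<psi> assume "p \<in> charts (opposite M)" "p = (U, \<psi>)"
  then have "(U, \<psi>) \<in> charts (opposite M)" by simp
  then obtain \<phi> and R R' :: "real ^ 'n ^ 'n" where U: "(U, \<phi>) \<in> charts M" and \<psi>: "\<psi> = (\<lambda>x. R *v \<phi> x)"
      and R: "\<And>v. R *v (R' *v v) = v" "\<And>v. R' *v (R *v v) = v"
    using opposite_chartE by blast
  have ch: "is_chart (top_of M) (U, \<phi>)"
    using M U unfolding closed_oriented_manifold_def by blast
  note inj = is_chart_open_image(2)[OF ch]
  have "open (\<phi> ` U)" using ch by (simp add: is_chart_def)
  have S: "open (\<psi> ` U)"
    using open_image_matrix[OF R \<open>open (\<phi> ` U)\<close>] by (simp add: \<psi> image_image)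
  have inj': "inj_on \<psi> U" using inj R(2) unfolding \<psi> inj_on_def by metis
  have eq: "(f \<circ> inv_into U \<phi>) (R' *v z) = (f \<circ> inv_into U \<psi>) z" if "z \<in> \<psi> ` U" for z
  proof -
    obtain x where x: "z = \<psi> x" "x \<in> U" using \<open>z \<in> \<psi> ` U\<close> by blast
    then have "inv_into U \<psi> z = x" using inj' by simp
    moreover have "R' *v z = \<phi> x" using R(2) by (simp add: x(1) \<psi>)
    ultimately show ?thesis using inj x(2) by simp
  qed
  have f': "smooth_on (\<phi> ` U) (f \<circ> inv_into U \<phi>)"
      "x \<in> U \<Longrightarrow> tot_real (frechet_derivative (f \<circ> inv_into U \<phi>) (at (\<phi> x)))" for x
    using f U unfolding totally_real_on_def by auto
  have bl: "bounded_linear (\<lambda>v. A *v v)" for A :: "real ^ 'n ^ 'n"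
    by (rule matrix_vector_mul_bounded_linear)
  have R'_smooth: "smooth_on (\<psi> ` U) (\<lambda>v. R' *v v)"
    by (rule smooth_on_linear[OF bl smooth_on_id S])
  have sub: "(\<lambda>v. R' *v v) ` \<psi> ` U \<subseteq> \<phi> ` U" using R(2) by (auto simp: \<psi>)
  have sm: "smooth_on (\<psi> ` U) (\<lambda>z. (f \<circ> inv_into U \<phi>) (R' *v z))"
    by (rule smooth_on_compose[OF R'_smooth f'(1) sub S])
  show "smooth_on (\<psi> ` (U \<inter> UNIV)) (f \<circ> inv_into U \<psi>) \<and>
     (\<forall>x \<in> U \<inter> UNIV. tot_real (frechet_derivative (f \<circ> inv_into U \<psi>) (at (\<psi> x))))"
  proof (intro conjI ballI; simp only: Int_UNIV_right)
    show "smooth_on (\<psi> ` U) (f \<circ> inv_into U \<psi>)"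
      by (rule smooth_on_cong[OF S sm]) (rule eq)
    fix x assume x: "x \<in> U"
    then have z: "\<psi> x \<in> \<psi> ` U" by blast
    have "tot_real (frechet_derivative (\<lambda>z. (f \<circ> inv_into U \<phi>) (R' *v z)) (at (\<psi> x)))"
    proof (rule tot_real_derivative_compose[OF R'_smooth S _ f'(1) sub _ z])
      show "smooth_on (\<phi> ` U) (\<lambda>v. R *v v)"
        by (rule smooth_on_linear[OF bl smooth_on_id \<open>open (\<phi> ` U)\<close>])
      show "tot_real (frechet_derivative (f \<circ> inv_into U \<phi>) (at (R' *v \<psi> x)))"
        using f'(2)[OF x] R(2) by (simp add: \<psi>)
    qed (rule R(1))
    moreover have "(\<lambda>z. (f \<circ> inv_into U \<phi>) (R' *v z)) differentiable (at (\<psi> x))"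
      using smooth_on_has_derivative[OF sm z] by (auto simp: differentiable_def)
    then have "frechet_derivative (\<lambda>z. (f \<circ> inv_into U \<phi>) (R' *v z)) (at (\<psi> x)) =
        frechet_derivative (f \<circ> inv_into U \<psi>) (at (\<psi> x))"
      by (rule frechet_derivative_transform_within_open[OF _ S z]) (rule eq)
    ultimately show "tot_real (frechet_derivative (f \<circ> inv_into U \<psi>) (at (\<psi> x)))"
      by simp
  qed
qed

section \<open>Passage to the charts of the connected sum\<close>

lemma totally_real_on_cong:
  assumes "\<And>U \<phi>. (U, \<phi>) \<in> charts M \<Longrightarrow> U \<inter> T = U \<inter> S" and "totally_real_on M S f"
  shows "totally_real_on M T f"
  unfolding totally_real_on_def
proof (intro ballI case_prodI2)
  fix p U \<phi> assume "p \<in> charts M" "p = (U, \<phi>)"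
  then have U: "(U, \<phi>) \<in> charts M" by simp
  then show "smooth_on (\<phi> ` (U \<inter> T)) (f \<circ> inv_into U \<phi>) \<and>
     (\<forall>x \<in> U \<inter> T. tot_real (frechet_derivative (f \<circ> inv_into U \<phi>) (at (\<phi> x))))"
    using assms(2) unfolding assms(1)[OF U] totally_real_on_def by blast
qed

text \<open>A pushed chart has the same coordinate image as the original chart restricted to
  \<open>S\<close>, and \<open>F\<close> has the same coordinate expression there as
  \<open>f\<close>; so all conditions carry over verbatim.\<close>

lemma totally_real_push_charts:
  fixes M :: "('a, 'n::finite) oriented_manifold" and j :: "'a \<Rightarrow> 'c"
  assumes f: "totally_real_on M S f" and j: "inj_on j S"
    and F: "\<And>x. x \<in> S \<Longrightarrow> F (j x) = f x"
    and chart: "\<And>U \<phi>. (U, \<phi>) \<in> charts M \<Longrightarrow> inj_on \<phi> U"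
      "\<And>U \<phi>. (U, \<phi>) \<in> charts M \<Longrightarrow> open (\<phi> ` (U \<inter> S))"
    and V: "(V, \<psi>) \<in> push_charts S j (charts M)"
  shows "smooth_on (\<psi> ` V) (F \<circ> inv_into V \<psi>) \<and>
    (\<forall>y \<in> V. tot_real (frechet_derivative (F \<circ> inv_into V \<psi>) (at (\<psi> y))))"
proof -
  obtain U \<phi> where U: "(U, \<phi>) \<in> charts M" "V = j ` (U \<inter> S)" "\<psi> = \<phi> \<circ> inv_into S j"
    using V by (auto simp: push_charts_def)
  have psi: "\<psi> (j x) = \<phi> x" if "x \<in> U \<inter> S" for x
    using that j U by simp
  have T: "\<psi> ` V = \<phi> ` (U \<inter> S)"
    unfolding U(2) image_image using psi by (rule image_cong[OF refl])
  have "inj_on \<psi> V"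
    unfolding U(2) by (rule inj_onI) (use psi chart(1)[OF U(1)] in \<open>auto dest: inj_onD\<close>)
  then have inv: "inv_into V \<psi> (\<phi> x) = j x" if "x \<in> U \<inter> S" for x
    using inv_into_f_f[of \<psi> V "j x"] psi[OF that] that U(2) by auto
  have eq: "(f \<circ> inv_into U \<phi>) z = (F \<circ> inv_into V \<psi>) z" if "z \<in> \<phi> ` (U \<inter> S)" for z
    using that inv F chart(1)[OF U(1)] by auto
  have f': "smooth_on (\<phi> ` (U \<inter> S)) (f \<circ> inv_into U \<phi>)"
      "x \<in> U \<inter> S \<Longrightarrow> tot_real (frechet_derivative (f \<circ> inv_into U \<phi>) (at (\<phi> x)))" for x
    using f U(1) unfolding totally_real_on_def by auto
  show ?thesis
  proof
    show "smooth_on (\<psi> ` V) (F \<circ> inv_into V \<psi>)"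
      unfolding T by (rule smooth_on_cong[OF chart(2)[OF U(1)] f'(1)]) (rule eq)
    show "\<forall>y \<in> V. tot_real (frechet_derivative (F \<circ> inv_into V \<psi>) (at (\<psi> y)))"
    proof
      fix y assume "y \<in> V"
      then obtain x where x: "y = j x" "x \<in> U \<inter> S" using U(2) by blast
      then have z: "\<phi> x \<in> \<phi> ` (U \<inter> S)" by blast
      have "(f \<circ> inv_into U \<phi>) differentiable (at (\<phi> x))"
        using smooth_on_has_derivative[OF f'(1) z] by (auto simp: differentiable_def)
      then have "frechet_derivative (f \<circ> inv_into U \<phi>) (at (\<phi> x)) = frechet_derivative (F \<circ> inv_into V \<psi>) (at (\<phi> x))"
        by (rule frechet_derivative_transform_within_open[OF _ chart(2)[OF U(1)] z]) (rule eq)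
      then show "tot_real (frechet_derivative (F \<circ> inv_into V \<psi>) (at (\<psi> y)))"
        using f'(2)[OF x(2)] psi[OF x(2)] x(1) by simp
    qed
  qed
qed

lemma csum_inl_eq_inr:
  assumes "csum_inl M1 M2 i1 i2 x = csum_inr M1 M2 i1 i2 y" and "y \<in> punctured M2 i2"
  obtains t u where "norm u = 1" "0 < t" "t < 1" "x = i1 (t *\<^sub>R u)" "y = i2 ((1 - t) *\<^sub>R u)"
proof -
  have "Inr y \<in> csum_inr M1 M2 i1 i2 y"
    using assms(2) by (auto simp: csum_inr_def gluing_def)
  then have "(Inl x, Inr y) \<in> gluing M1 M2 i1 i2"
    using assms(1) by (auto simp: csum_inl_def)
  then show thesis
    using that by (auto simp: gluing_def glued_def)
qed

theorem theorem2:
  fixes M1 :: "('a, 'n::finite) oriented_manifold"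
    and M2 :: "('b, 'n) oriented_manifold"
  assumes "closed_oriented_manifold M1"
    and "closed_oriented_manifold M2"
    and "\<exists>f. totally_real_immersion M1 f"
    and "\<exists>f. totally_real_immersion M2 f"
    and "preserving_disc M1 i1"
    and "reversing_disc (opposite M2) i2"
  shows "\<exists>f. totally_real_immersion (connected_sum M1 (opposite M2) i1 i2) f"
proof -
  let ?M2 = "opposite M2"
  obtain W1 where W1: "open_embedding M1 W1 i1" "cball 0 1 \<subseteq> W1"
    using assms(5) by (auto simp: preserving_disc_def)
  obtain W2 where W2: "open_embedding ?M2 W2 i2" "cball 0 1 \<subseteq> W2"
    using assms(6) by (auto simp: reversing_disc_def)
  interpret D1: disc_in_manifold M1 W1 i1
    by (rule disc_in_closed_manifold[OF assms(1) W1])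
  interpret D2: disc_in_manifold ?M2 W2 i2
    by (rule disc_in_opposite[OF assms(2) W2])
  obtain f1 where f1: "totally_real_on M1 UNIV f1" "f1 (i1 0) = 0"
    "frechet_derivative (f1 \<circ> i1) (at 0) = incl"
    using assms(3) D1.normalise unfolding totally_real_immersion_iff by metis
  obtain f2 where f2: "totally_real_on ?M2 UNIV f2" "f2 (i2 0) = 0"
    "frechet_derivative (f2 \<circ> i2) (at 0) = incl"
    using assms(4) totally_real_on_opposite[OF assms(2)] D2.normalise
    unfolding totally_real_immersion_iff by metis
  obtain r1 where r1: "0 < r1" "\<And>y v. norm y < r1 \<Longrightarrow>
      norm (frechet_derivative (f1 \<circ> i1) (at y) v - incl v) \<le> norm v / 4"
    using derivative_near_incl[OF D1.pull_back(1)[OF f1(1)] D1.open_W D1.zero_W f1(3)] by blast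
  obtain r2 where r2: "0 < r2" "\<And>y v. norm y < r2 \<Longrightarrow>
      norm (frechet_derivative (f2 \<circ> i2) (at y) v - incl v) \<le> norm v / 4"
    using derivative_near_incl[OF D2.pull_back(1)[OF f2(1)] D2.open_W D2.zero_W f2(3)] by blast
  \<comment> \<open>One profile must serve both sides, since each side sees both radial maps; hence
    the minimum of the two radii.\<close>
  obtain a a' where a: "radial_profile (min r1 r2) a a'"
    using radial_profile_exists[of "min r1 r2"] r1(1) r2(1) by auto
  note g1 = smooth_on_mono[OF D1.pull_back(1)[OF f1(1)] D1.ball_W]
      D1.pull_back(2)[OF f1(1) subsetD[OF D1.ball_W]]
    and g2 = smooth_on_mono[OF D2.pull_back(1)[OF f2(1)] D2.ball_W]
      D2.pull_back(2)[OF f2(1) subsetD[OF D2.ball_W]]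
  have near: "norm (frechet_derivative (f1 \<circ> i1) (at y) v - incl v) \<le> norm v / 4"
    "norm (frechet_derivative (f2 \<circ> i2) (at y) v - incl v) \<le> norm v / 4"
    if "norm y < min r1 r2" for y v
    using that r1(2)[of y v] r2(2)[of y v] by simp_all
  define F1 where "F1 = D1.attach 1 a f1 (f2 \<circ> i2)"
  \<comment> \<open>The factor \<open>J\<close> turns the view from the second manifold into that
    from the first; subtracting 0 matches the affine form of
    \<open>totally_real_on_linear\<close>.\<close>
  define F2 where "F2 y = J (D2.attach (- 1) a f2 (f1 \<circ> i1) y - 0)" for y
  have F1: "totally_real_on M1 (- {i1 0}) F1"
    unfolding F1_def
    by (rule D1.attach_totally_real[OF a _ f1(1) near(1) g2 near(2)]) (auto simp: f2(2))
  have "totally_real_on ?M2 (- {i2 0}) (D2.attach (- 1) a f2 (f1 \<circ> i1))"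
    by (rule D2.attach_totally_real[OF a _ f2(1) near(2) g1 near(1)]) (auto simp: f1(2))
  then have F2: "totally_real_on ?M2 (- {i2 0}) F2"
    unfolding F2_def by (rule totally_real_on_linear[OF _ linear_J]) (auto intro: D2.open_chart_punctured)
  \<comment> \<open>At radius 1 - t the two radial maps exchange their roles, and J (g2 - J g1) = g1
    + J g2 is the neck as seen from the first manifold.\<close>
  have glue: "F1 (i1 (t *\<^sub>R u)) = F2 (i2 ((1 - t) *\<^sub>R u))" if "norm u = 1" "0 < t" "t < 1" for t u
  proof -
    have "t *\<^sub>R u \<in> ball 0 1 - {0}" "(1 - t) *\<^sub>R u \<in> ball 0 1 - {0}"
      using that by auto
    then show ?thesis
      using that unfolding F1_def F2_def
      by (simp add: D1.attach_disc D2.attach_disc neck_def radial_def J_add J_diff J_J J_minus)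
  qed
  let ?inl = "csum_inl M1 ?M2 i1 i2" and ?inr = "csum_inr M1 ?M2 i1 i2"
  let ?S1 = "punctured M1 i1" and ?S2 = "punctured ?M2 i2"
  define F where "F C = (if C \<in> ?inl ` ?S1 then F1 (inv_into ?S1 ?inl C) else F2 (inv_into ?S2 ?inr C))" for C
  have F_inl: "F (?inl x) = F1 x" if "x \<in> ?S1" for x
    using that by (simp add: F_def inv_into_f_f[OF csum_inl_inj])
  have F_inr: "F (?inr y) = F2 y" if y: "y \<in> ?S2" for y
  proof (cases "?inr y \<in> ?inl ` ?S1")
    \<comment> \<open>A class that meets both sides comes from a glued pair, where \<open>F1\<close>
      and \<open>F2\<close> agree, so the preference for \<open>F1\<close> in the definition of
      \<open>F\<close> does no harm.\<close>
    case True
    then obtain x where x: "x \<in> ?S1" "?inl x = ?inr y" by auto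
    show ?thesis
      using csum_inl_eq_inr[OF x(2) y] glue F_inl[OF x(1)] x(2) by metis
  next
    case False
    then show ?thesis using y by (simp add: F_def inv_into_f_f[OF csum_inr_inj])
  qed
  have punct: "U \<inter> ?S1 = U \<inter> - {i1 0}" if "openin (top_of M1) U" for U
    using openin_subset[OF that] by (auto simp: punctured_def)
  have punct': "U \<inter> ?S2 = U \<inter> - {i2 0}" if "openin (top_of ?M2) U" for U
    using openin_subset[OF that] by (auto simp: punctured_def)
  have T1: "totally_real_on M1 ?S1 F1"
    by (rule totally_real_on_cong[OF _ F1]) (simp add: punct D1.chart(1))
  have T2: "totally_real_on ?M2 ?S2 F2"
    by (rule totally_real_on_cong[OF _ F2]) (simp add: punct' D2.chart(1))
  have "totally_real_on (connected_sum M1 ?M2 i1 i2) UNIV F"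
    unfolding totally_real_on_def Int_UNIV_right
  proof (intro ballI case_prodI2)
    fix p V \<psi> assume "p \<in> charts (connected_sum M1 ?M2 i1 i2)" "p = (V, \<psi>)"
    then consider "(V, \<psi>) \<in> push_charts ?S1 ?inl (charts M1)"
      | "(V, \<psi>) \<in> push_charts ?S2 ?inr (charts ?M2)"
      by (auto simp: connected_sum_def)
    then show "smooth_on (\<psi> ` V) (F \<circ> inv_into V \<psi>) \<and>
      (\<forall>y \<in> V. tot_real (frechet_derivative (F \<circ> inv_into V \<psi>) (at (\<psi> y))))"
    proof cases
      case 1
      show ?thesis
        by (rule totally_real_push_charts[OF T1 csum_inl_inj F_inl D1.chart(2) _ 1])
           (simp_all add: punct D1.chart(1) D1.open_chart_punctured)
    next
      case 2
      show ?thesis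
        by (rule totally_real_push_charts[OF T2 csum_inr_inj F_inr D2.chart(2) _ 2])
           (simp_all add: punct' D2.chart(1) D2.open_chart_punctured)
    qed
  qed
  then show ?thesis
    using totally_real_immersion_iff by blast
qed

end
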